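(* Let $M$ be a matroid with a basis $B_0$, and suppose that every dead stratum admits a fibre, i.e. let $F$ be a fibre system on $(M,B_0)$ (a choice of a fibre $F(\sigma)$ at every dead stratum $\sigma$). Then the set $\mathcal P^*(F)\subseteq\mathbb N^R$ of relaxed coparking functions is a pure multicomplex whose degree sequence is the $h$-vector $h(M)$ of $M$. In particular, if $(M,B_0)$ carries a fibre system, then Stanley's conjecture holds for $M$, i.e. $h(M)$ is a pure $O$-sequence.
   Context: $M$ is a matroid on a finite ground set $E$ with rank function $r$ and fixed basis $B_0$; $R=E\setminus B_0$. For $i\in R$, $C_i$ is the fundamental circuit of $i$, the unique circuit contained in $B_0\cup\{i\}$. For $\sigma\subseteq R$ and $e\in E$ put $m_\sigma(e)=\#\{i\in\sigma: e\in C_i\}$, $U_\sigma=\{e\in E: m_\sigma(e)=1\}$ and $A_\sigma=\{e\in E: m_\sigma(e)\ge 1\}$. A stratum is a nonempty subset $\sigma\subseteq R$. It is dead if $U_\sigma$ is independent in $M$, and live otherwise. The baseline $b_\sigma\in\mathbb N^\sigma$ is $b_\sigma(i)=|C_i\cap U_\sigma|$. $\mathbb N^\sigma$ is identified with the vectors in $\mathbb N^R$ vanishing outside $\sigma$. A stratum $\sigma$ can be fired from $a\in\mathbb N^R$ if $a_i\ge b_\sigma(i)$ for all $i\in\sigma$. For a dead stratum $\sigma$ the dead node is the matroid $K_\sigma=(M|A_\sigma)/U_\sigma$. $h$-vector: for a matroid $N$ of rank $d$, $h(N)=(h_0,\dots,h_d)$ is the $h$-vector of its independence complex, determined by $T_N(x,1)=\sum_k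 h_kx^{d-k}$ with $T_N$ the Tutte polynomial. A multicomplex is a finite set of monomials (identified with exponent vectors) closed under division; the degree of $a$ is $|a|=\sum a_i$; it is pure if all its maximal elements have the same degree; its degree sequence counts the elements of each degree (sequences are identified with their generating polynomials, so trailing zeros are ignored). A pure $O$-sequence is the degree sequence of a pure multicomplex. Fibres, defined recursively along inclusion: let $\sigma$ be a dead stratum and suppose fibres $F(\tau)\subseteq\mathbb N^\tau$ have been chosen at all dead strata $\tau\subsetneq\sigma$. A fibre at $\sigma$ is a set $F(\sigma)\subseteq\mathbb N^\sigma$ such that (i) $F(\sigma)$ is a pure multicomplex with degree sequence $h(K_\sigma)$; (ii) for every $m\in F(\sigma)$, every stratum $\tau\subsetneq\sigma$ that can be fired from $b_\sigma+m$ is dead and satisfies $(b_\sigma+m)|_\tau-b_\tau\in F(\tau)$. A fibre system $F$ on $(M,B_0)$ is a choice of a fibre $F(\sigma)$ at every dead stratum $\sigma$ (relative to the chosen fibres strictly inside $\sigma$). $\mathcal P^*(F)$ is the set of $a\in\mathbb N^R$ such that every stratum $\tau$ that can be fired from $a$ is dead and satisfies $a|_\tau-b_\tau\in F(\tau)$. *)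

theory Defs
  imports "HOL-Computational_Algebra.Polynomial"
begin

section \<open>Matroids and their minors\<close>

record 'a indep_structure =
  ground :: "'a set"
  indeps :: "'a set set"

locale matroid =
  fixes M :: "'a indep_structure"
  assumes finite_ground: "finite (ground M)"
    and indeps_subset: "I \<in> indeps M \<Longrightarrow> I \<subseteq> ground M"
    and empty_indep: "{} \<in> indeps M"
    and indeps_down: "I \<in> indeps M \<Longrightarrow> J \<subseteq> I \<Longrightarrow> J \<in> indeps M"
    and augmentation: "I \<in> indeps M \<Longrightarrow> J \<in> indeps M \<Longrightarrow> card I < card J \<Longrightarrow>
      \<exists>e \<in> J - I. insert e I \<in> indeps M"

definition basis :: "'a indep_structure \<Rightarrow> 'a set \<Rightarrow> bool" where
  "basis M B \<longleftrightarrow> B \<in> indeps M \<and> (\<forall>I \<in> indeps M. B \<subseteq> I \<longrightarrow> I = B)"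

definition circuit :: "'a indep_structure \<Rightarrow> 'a set \<Rightarrow> bool" where
  "circuit M C \<longleftrightarrow> C \<subseteq> ground M \<and> C \<notin> indeps M \<and> (\<forall>D. D \<subset> C \<longrightarrow> D \<in> indeps M)"

definition rank :: "'a indep_structure \<Rightarrow> 'a set \<Rightarrow> nat" where
  "rank M X = Max (card ` {I \<in> indeps M. I \<subseteq> X})"

definition restriction :: "'a indep_structure \<Rightarrow> 'a set \<Rightarrow> 'a indep_structure" where
  "restriction M A = \<lparr>ground = ground M \<inter> A, indeps = {I \<in> indeps M. I \<subseteq> A}\<rparr>"

text \<open>The independent sets of \<open>M/U\<close> are those of full rank with respect to the rank
  function \<open>X \<mapsto> r(X \<union> U) - r(U)\<close>.\<close>

definition contraction :: "'a indep_structure \<Rightarrow> 'a set \<Rightarrow> 'a indep_structure" where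
  "contraction M U = \<lparr>ground = ground M - U,
     indeps = {I. I \<subseteq> ground M - U \<and> rank M (I \<union> U) = card I + rank M U}\<rparr>"


section \<open>The Tutte polynomial and the \<open>h\<close>-vector\<close>

text \<open>A bivariate polynomial in \<open>x\<close> and \<open>y\<close> is a polynomial in \<open>y\<close> over \<open>\<int>[x]\<close>:
  below, \<open>[:[:-1, 1:]:]\<close> is \<open>x - 1\<close> and \<open>[:-1, 1:]\<close> is \<open>y - 1\<close>. Evaluating with
  \<open>poly _ 1\<close> therefore substitutes \<open>y = 1\<close> and leaves a polynomial in \<open>x\<close>.\<close>

definition tutte :: "'a indep_structure \<Rightarrow> int poly poly" where
  "tutte M = (\<Sum>A \<in> Pow (ground M).
     [:[:-1, 1:]:] ^ (rank M (ground M) - rank M A) * [:-1, 1:] ^ (card A - rank M A))"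

text \<open>Sequences are padded with zeros.\<close>

definition h_vector :: "'a indep_structure \<Rightarrow> nat \<Rightarrow> int" where
  "h_vector M k = (let d = rank M (ground M) in
     if k \<le> d then coeff (poly (tutte M) 1) (d - k) else 0)"


section \<open>Multicomplexes\<close>

text \<open>A monomial is identified with its exponent vector, a finitely supported function
  into \<open>nat\<close>; divisibility is the pointwise order. For a set \<open>S\<close> of variables,
  \<open>exponents S\<close> is \<open>\<nat>\<^sup>S\<close>, extended by zero.\<close>

definition exponents :: "'v set \<Rightarrow> ('v \<Rightarrow> nat) set" where
  "exponents S = {a. \<forall>i. i \<notin> S \<longrightarrow> a i = 0}"

definition total_degree :: "('v \<Rightarrow> nat) \<Rightarrow> nat" where
  "total_degree a = (\<Sum>i | a i \<noteq> 0. a i)"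

definition multicomplex :: "('v \<Rightarrow> nat) set \<Rightarrow> bool" where
  "multicomplex \<Delta> \<longleftrightarrow> finite \<Delta> \<and> (\<forall>a \<in> \<Delta>. finite {i. a i \<noteq> 0}) \<and>
     (\<forall>a \<in> \<Delta>. \<forall>b. b \<le> a \<longrightarrow> b \<in> \<Delta>)"

definition maximal_in :: "('v \<Rightarrow> nat) set \<Rightarrow> ('v \<Rightarrow> nat) \<Rightarrow> bool" where
  "maximal_in \<Delta> a \<longleftrightarrow> a \<in> \<Delta> \<and> (\<forall>b \<in> \<Delta>. a \<le> b \<longrightarrow> b = a)"

definition pure_multicomplex :: "('v \<Rightarrow> nat) set \<Rightarrow> bool" where
  "pure_multicomplex \<Delta> \<longleftrightarrow> multicomplex \<Delta> \<and>
     (\<forall>a b. maximal_in \<Delta> a \<longrightarrow> maximal_in \<Delta> b \<longrightarrow> total_degree a = total_degree b)"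

definition degree_sequence :: "('v \<Rightarrow> nat) set \<Rightarrow> nat \<Rightarrow> int" where
  "degree_sequence \<Delta> k = int (card {a \<in> \<Delta>. total_degree a = k})"

text \<open>A finite multicomplex involves finitely many variables, so it is no restriction to
  index them by natural numbers.\<close>

definition pure_O_sequence :: "(nat \<Rightarrow> int) \<Rightarrow> bool" where
  "pure_O_sequence h \<longleftrightarrow>
     (\<exists>\<Delta> :: (nat \<Rightarrow> nat) set. pure_multicomplex \<Delta> \<and> degree_sequence \<Delta> = h)"


section \<open>Strata\<close>

definition fundamental_circuit :: "'a indep_structure \<Rightarrow> 'a set \<Rightarrow> 'a \<Rightarrow> 'a set" where
  "fundamental_circuit M B0 i = (THE C. circuit M C \<and> C \<subseteq> B0 \<union> {i})"

definition mult :: "'a indep_structure \<Rightarrow> 'a set \<Rightarrow> 'a set \<Rightarrow> 'a \<Rightarrow> nat" where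
  "mult M B0 \<sigma> e = card {i \<in> \<sigma>. e \<in> fundamental_circuit M B0 i}"

definition U_set :: "'a indep_structure \<Rightarrow> 'a set \<Rightarrow> 'a set \<Rightarrow> 'a set" where
  "U_set M B0 \<sigma> = {e \<in> ground M. mult M B0 \<sigma> e = 1}"

definition A_set :: "'a indep_structure \<Rightarrow> 'a set \<Rightarrow> 'a set \<Rightarrow> 'a set" where
  "A_set M B0 \<sigma> = {e \<in> ground M. mult M B0 \<sigma> e \<ge> 1}"

definition stratum :: "'a indep_structure \<Rightarrow> 'a set \<Rightarrow> 'a set \<Rightarrow> bool" where
  "stratum M B0 \<sigma> \<longleftrightarrow> \<sigma> \<noteq> {} \<and> \<sigma> \<subseteq> ground M - B0"

definition dead :: "'a indep_structure \<Rightarrow> 'a set \<Rightarrow> 'a set \<Rightarrow> bool" where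
  "dead M B0 \<sigma> \<longleftrightarrow> stratum M B0 \<sigma> \<and> U_set M B0 \<sigma> \<in> indeps M"

definition baseline :: "'a indep_structure \<Rightarrow> 'a set \<Rightarrow> 'a set \<Rightarrow> 'a \<Rightarrow> nat" where
  "baseline M B0 \<sigma> i =
     (if i \<in> \<sigma> then card (fundamental_circuit M B0 i \<inter> U_set M B0 \<sigma>) else 0)"

definition can_fire :: "'a indep_structure \<Rightarrow> 'a set \<Rightarrow> 'a set \<Rightarrow> ('a \<Rightarrow> nat) \<Rightarrow> bool" where
  "can_fire M B0 \<sigma> a \<longleftrightarrow> stratum M B0 \<sigma> \<and> (\<forall>i \<in> \<sigma>. baseline M B0 \<sigma> i \<le> a i)"

definition dead_node :: "'a indep_structure \<Rightarrow> 'a set \<Rightarrow> 'a set \<Rightarrow> 'a indep_structure" where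
  "dead_node M B0 \<sigma> = contraction (restriction M (A_set M B0 \<sigma>)) (U_set M B0 \<sigma>)"


section \<open>Fibre systems and relaxed coparking functions\<close>

text \<open>The vector \<open>a|\<^sub>\<tau> - b\<^sub>\<tau>\<close>; the subtraction is truncated, but is only used when \<open>\<tau>\<close> can
  be fired from \<open>a\<close>.\<close>

definition residual ::
  "'a indep_structure \<Rightarrow> 'a set \<Rightarrow> 'a set \<Rightarrow> ('a \<Rightarrow> nat) \<Rightarrow> ('a \<Rightarrow> nat)" where
  "residual M B0 \<tau> a = (\<lambda>i. if i \<in> \<tau> then a i - baseline M B0 \<tau> i else 0)"

text \<open>\<open>is_fibre M B0 F \<sigma> X\<close>: the set \<open>X\<close> is a fibre at \<open>\<sigma>\<close> relative to the sets \<open>F \<tau>\<close> at the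
  dead strata \<open>\<tau>\<close> strictly inside \<open>\<sigma>\<close>; no other values of \<open>F\<close> matter. Values of a fibre
  system away from the dead strata are irrelevant.\<close>

definition is_fibre ::
  "'a indep_structure \<Rightarrow> 'a set \<Rightarrow> ('a set \<Rightarrow> ('a \<Rightarrow> nat) set) \<Rightarrow> 'a set \<Rightarrow> ('a \<Rightarrow> nat) set \<Rightarrow> bool"
  where
  "is_fibre M B0 F \<sigma> X \<longleftrightarrow> X \<subseteq> exponents \<sigma> \<and>
     pure_multicomplex X \<and> degree_sequence X = h_vector (dead_node M B0 \<sigma>) \<and>
     (\<forall>m \<in> X. \<forall>\<tau>. \<tau> \<subset> \<sigma> \<longrightarrow> can_fire M B0 \<tau> (\<lambda>i. baseline M B0 \<sigma> i + m i) \<longrightarrow>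
        dead M B0 \<tau> \<and> residual M B0 \<tau> (\<lambda>i. baseline M B0 \<sigma> i + m i) \<in> F \<tau>)"

definition fibre_system ::
  "'a indep_structure \<Rightarrow> 'a set \<Rightarrow> ('a set \<Rightarrow> ('a \<Rightarrow> nat) set) \<Rightarrow> bool" where
  "fibre_system M B0 F \<longleftrightarrow> (\<forall>\<sigma>. dead M B0 \<sigma> \<longrightarrow> is_fibre M B0 F \<sigma> (F \<sigma>))"

definition relaxed_coparking ::
  "'a indep_structure \<Rightarrow> 'a set \<Rightarrow> ('a set \<Rightarrow> ('a \<Rightarrow> nat) set) \<Rightarrow> ('a \<Rightarrow> nat) set" where
  "relaxed_coparking M B0 F = {a \<in> exponents (ground M - B0).
     \<forall>\<tau>. can_fire M B0 \<tau> a \<longrightarrow> dead M B0 \<tau> \<and> residual M B0 \<tau> a \<in> F \<tau>}"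

end

theory Submission
  imports Defs "HOL-Computational_Algebra.Polynomial_FPS"
begin

text \<open>
  Baselines shrink as a stratum grows, so a union of strata that can be fired from \<open>a\<close> can be
  fired again, and there is a largest such stratum \<open>\<rho>\<close> (possibly empty). Splitting \<open>a\<close> there
  gives \<open>a = b\<^sub>\<rho> + m + c\<close>, where \<open>m\<close> lives on \<open>\<rho>\<close> and \<open>c\<close> is a coparking function relative to
  \<open>\<rho>\<close>: a vector on \<open>R - \<rho>\<close> from which no larger stratum can be fired. The second condition on
  a fibre says that the strata inside \<open>\<rho>\<close> impose nothing beyond \<open>m \<in> F \<rho>\<close>, so \<open>a\<close> is a relaxed
  coparking function iff \<open>\<rho>\<close> is empty, or dead with \<open>m \<in> F \<rho>\<close> (\<open>relaxed_coparking_iff\<close>). Writing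
  \<open>P\<^sub>\<rho>\<close> for the degree generating function of the coparking functions relative to \<open>\<rho>\<close>, the
  relaxed coparking functions have generating function
  \<open>\<Sum>\<^sub>\<rho> X\<^bsup>|U\<^sub>\<rho>|\<^esup> h(K\<^sub>\<rho>) P\<^sub>\<rho>\<close>, summed over the dead strata and \<open>\<rho> = {}\<close>. What
  has to be shown is that this sum is \<open>h(M)\<close> (\<open>h_gf_decomposition\<close>). This is a statement about \<open>M\<close> alone.

  It is proved by reading \<open>X\<close> as a probability. Let \<open>Z\<close> be a random subset of the ground set
  containing each element independently with probability \<open>X\<close>. Then \<open>(1 - X)\<^bsup>|R|\<^esup> h(M)\<close> is
  the probability that \<open>Z\<close> is independent, and \<open>(1 - X)\<^bsup>|\<rho>|\<^esup> X\<^bsup>|U\<^sub>\<rho>|\<^esup> h(K\<^sub>\<rho>)\<close> is the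
  probability that \<open>Z \<inter> A\<^sub>\<rho>\<close> is independent and contains \<open>U\<^sub>\<rho>\<close>. Let \<open>W\<^sub>\<sigma>\<close> be the expected
  Moebius coefficient at \<open>\<sigma>\<close> of the indicator \<open>\<tau> \<mapsto> [Z \<inter> A\<^sub>\<tau> independent]\<close>. The first
  probability is \<open>\<Sum>\<^sub>\<sigma> W\<^sub>\<sigma>\<close>. For the second, suppose that \<open>Z\<close> misses an element \<open>e\<close> that
  lies in \<open>C\<^sub>i\<close> for one \<open>i \<in> \<sigma>\<close> only. Apart from \<open>e\<close>, adjoining \<open>C\<^sub>i\<close> to a set
  \<open>A\<^sub>\<tau>\<close> with \<open>\<tau> \<subseteq> \<sigma> - {i}\<close> only adds coloops, so the indicator does not notice whether \<open>i \<in> \<tau>\<close>, and the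
  coefficient at \<open>\<sigma>\<close> vanishes (\<open>indep_insert_private\<close>, \<open>defect_eq_0\<close>). Hence the second
  probability is \<open>\<Sum>\<^sub>\<sigma> X\<^bsup>|U\<^sub>\<rho> - A\<^sub>\<sigma>|\<^esup> W\<^sub>\<sigma>\<close>, summed over \<open>\<sigma> \<subseteq> \<rho>\<close>. Finally, splitting
  all vectors on \<open>R - \<sigma>\<close> at the largest stratum that can be fired above \<open>\<sigma>\<close> gives
  \<open>1 = \<Sum>\<^sub>\<rho> X\<^bsup>|U\<^sub>\<rho> - A\<^sub>\<sigma>|\<^esup> (1 - X)\<^bsup>|R - \<rho>|\<^esup> P\<^sub>\<rho>\<close>, summed over \<open>\<rho> \<supseteq> \<sigma>\<close>
  (\<open>coparking_orthant_identity\<close>); inserting this factor into \<open>\<Sum>\<^sub>\<sigma> W\<^sub>\<sigma>\<close> and exchanging the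
  sums yields the decomposition of \<open>h(M)\<close>.

  For purity, both parts of \<open>a = b\<^sub>\<rho> + m + c\<close> can be raised to a known degree without changing
  \<open>\<rho>\<close>. A burning order of \<open>R - \<rho>\<close> raises \<open>c\<close> to degree \<open>|A\<^sub>R - A\<^sub>\<rho>| - |R - \<rho>|\<close>
  (\<open>coparking_below_top_degree\<close>). The set \<open>A\<^sub>\<rho>\<close> is a union of circuits, so \<open>K\<^sub>\<rho>\<close> has no
  coloops and the last entry of its \<open>h\<close>-vector is positive (\<open>signed_count_pos\<close>); as the fibre is
  pure, \<open>m\<close> can be raised to degree \<open>r(A\<^sub>\<rho>) - |U\<^sub>\<rho>|\<close>. The degrees add up to
  \<open>|A\<^sub>R| - |R|\<close>, whatever \<open>\<rho>\<close> is.
\<close>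


section \<open>Rank in a matroid\<close>

lemma rank_attained:
  assumes "finite (indeps N)" and "{} \<in> indeps N"
  obtains I where "I \<in> indeps N" "I \<subseteq> X" "card I = rank N X"
proof -
  have "rank N X \<in> card ` {I \<in> indeps N. I \<subseteq> X}"
    unfolding rank_def using assms by (intro Max_in) auto
  then show ?thesis using that by auto
qed

lemma card_le_rank:
  assumes "finite (indeps N)" and "I \<in> indeps N" and "I \<subseteq> X"
  shows "card I \<le> rank N X"
  unfolding rank_def using assms by (intro Max_ge) auto

lemma rank_le_card:
  assumes "finite (indeps N)" and "{} \<in> indeps N" and "finite X"
  shows "rank N X \<le> card X"
  by (metis assms card_mono rank_attained)

lemma rank_eq_card_iff:
  assumes "finite (indeps N)" and "{} \<in> indeps N" and "finite X"
  shows "rank N X = card X \<longleftrightarrow> X \<in> indeps N"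
proof
  assume "rank N X = card X"
  then show "X \<in> indeps N"
    by (metis assms card_subset_eq rank_attained)
next
  assume "X \<in> indeps N"
  then show "rank N X = card X"
    using card_le_rank[OF assms(1), of X X] rank_le_card[OF assms] by auto
qed

context matroid
begin

lemma finite_indeps: "finite (indeps M)"
  by (rule finite_subset[of _ "Pow (ground M)"]) (use indeps_subset finite_ground in auto)

lemma finite_indep: "I \<in> indeps M \<Longrightarrow> finite I"
  using indeps_subset finite_ground finite_subset by blast

lemmas card_le_rank_M = card_le_rank[OF finite_indeps]
lemmas rank_le_card_M = rank_le_card[OF finite_indeps empty_indep]
lemmas rank_eq_card_iff_M = rank_eq_card_iff[OF finite_indeps empty_indep]

lemma extend_indep:
  assumes "I \<in> indeps M" "I \<subseteq> X"
  obtains J where "J \<in> indeps M" "I \<subseteq> J" "J \<subseteq> X" "card J = rank M X"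
proof -
  have "\<exists>J. J \<in> indeps M \<and> I \<subseteq> J \<and> J \<subseteq> X \<and> card J = rank M X"
    using assms
  proof (induction "rank M X - card I" arbitrary: I rule: less_induct)
    case less
    show ?case
    proof (cases "card I = rank M X")
      case True
      then show ?thesis using less.prems by blast
    next
      case False
      then have lt: "card I < rank M X"
        using card_le_rank_M[OF less.prems] by simp
      obtain K where K: "K \<in> indeps M" "K \<subseteq> X" "card K = rank M X"
        using rank_attained[OF finite_indeps empty_indep] .
      obtain e where e: "e \<in> K - I" "insert e I \<in> indeps M"
        using augmentation[OF less.prems(1) K(1)] lt K by auto
      have "rank M X - card (insert e I) < rank M X - card I"
        using e lt finite_indep[OF less.prems(1)] by simp
      from less.hyps[OF this e(2)] show ?thesis
        using e K(2) less.prems(2) by blast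
    qed
  qed
  then show ?thesis using that by blast
qed

lemma rank_mono: "X \<subseteq> Y \<Longrightarrow> rank M X \<le> rank M Y"
  by (metis card_le_rank_M empty_indep finite_indeps order_trans rank_attained)

lemma rank_insert_ge: "rank M X \<le> rank M (insert e X)"
  by (rule rank_mono) auto

lemma rank_insert_le: "rank M (insert e X) \<le> Suc (rank M X)"
proof -
  obtain I where I: "I \<in> indeps M" "I \<subseteq> insert e X" "card I = rank M (insert e X)"
    using rank_attained[OF finite_indeps empty_indep] .
  have "I - {e} \<in> indeps M" "I - {e} \<subseteq> X"
    using I indeps_down by auto
  then have "card (I - {e}) \<le> rank M X" by (rule card_le_rank_M)
  moreover have "card I \<le> Suc (card (I - {e}))"
    by (metis I(1) card.insert_remove card_mono finite.insertI finite_indep subset_insertI)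
  ultimately show ?thesis using I by simp
qed

text \<open>A basis of \<open>X\<close> extends to a basis of \<open>Y\<close>. If \<open>e\<close> raised the rank of \<open>Y\<close>, it could be added to
  the larger basis and hence to the smaller one. Equality of the two ranks is how ``\<open>e\<close> is spanned
  by \<open>X\<close>'' is expressed throughout.\<close>

lemma spanned_mono:
  assumes "rank M (insert e X) = rank M X" and "X \<subseteq> Y"
  shows "rank M (insert e Y) = rank M Y"
proof (rule ccontr)
  assume "rank M (insert e Y) \<noteq> rank M Y"
  with rank_insert_ge[of Y e] have lt: "rank M Y < rank M (insert e Y)" by auto
  obtain J where J: "J \<in> indeps M" "J \<subseteq> X" "card J = rank M X"
    using rank_attained[OF finite_indeps empty_indep] .
  obtain K where K: "K \<in> indeps M" "J \<subseteq> K" "K \<subseteq> Y" "card K = rank M Y"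
    using extend_indep[OF J(1)] J(2) assms(2) by (metis order_trans)
  obtain L where L: "L \<in> indeps M" "L \<subseteq> insert e Y" "card L = rank M (insert e Y)"
    using rank_attained[OF finite_indeps empty_indep] .
  obtain f where f: "f \<in> L - K" "insert f K \<in> indeps M"
    using augmentation[OF K(1) L(1)] K L lt by auto
  have "f = e"
  proof (rule ccontr)
    assume "f \<noteq> e"
    then have "insert f K \<subseteq> Y" using f L K by auto
    from card_le_rank_M[OF f(2) this] show False
      using f K finite_indep[OF K(1)] by simp
  qed
  then have "insert e J \<in> indeps M" "e \<notin> J"
    using f K indeps_down[OF f(2), of "insert e J"] by auto
  then have "Suc (card J) \<le> rank M (insert e X)"
    using card_le_rank_M[of "insert e J" "insert e X"] J finite_indep[OF J(1)] by auto
  then show False using J assms by simp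
qed

lemma rank_Un_spanned:
  assumes "finite Z" and "\<And>e. e \<in> Z \<Longrightarrow> rank M (insert e X) = rank M X"
  shows "rank M (X \<union> Z) = rank M X"
  using assms
proof (induction Z)
  case (insert e Z)
  have "rank M (insert e (X \<union> Z)) = rank M (X \<union> Z)"
    by (rule spanned_mono[of e X]) (use insert in auto)
  then show ?case using insert by simp
qed simp

text \<open>The rank equation says that all elements of \<open>Z - Y\<close> are coloops of the restriction to \<open>Z\<close>.
  Indeed, a basis of \<open>Y\<close> together with \<open>Z - Y\<close> spans \<open>Z\<close> and has as many elements as the rank of
  \<open>Z\<close>, so it is independent.\<close>

lemma coloop_extension:
  assumes "finite Z" and "Y \<subseteq> Z" and "rank M Z = rank M Y + card (Z - Y)"
    and "X \<subseteq> Z" and "X \<inter> Y \<in> indeps M"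
  shows "X \<in> indeps M"
proof -
  obtain J where J: "J \<in> indeps M" "X \<inter> Y \<subseteq> J" "J \<subseteq> Y" "card J = rank M Y"
    using extend_indep[OF assms(5), of Y] by auto
  let ?K = "J \<union> (Z - Y)"
  \<comment> \<open>The basis \<open>J\<close> spans all of \<open>Y\<close>.\<close>
  have "rank M (?K \<union> Y) = rank M ?K"
  proof (rule rank_Un_spanned)
    show "finite Y" using assms finite_subset by blast
    fix e assume "e \<in> Y"
    then have "rank M (insert e J) \<le> rank M Y" using J by (intro rank_mono) auto
    moreover have "card J \<le> rank M J" using J by (intro card_le_rank_M) auto
    ultimately have "rank M (insert e J) = rank M J"
      using J rank_insert_ge[of J e] by auto
    then show "rank M (insert e ?K) = rank M ?K" by (rule spanned_mono) auto
  qed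
  moreover have "?K \<union> Y = Z" using J assms by auto
  ultimately have "rank M ?K = rank M Y + card (Z - Y)" using assms by simp
  moreover have "card ?K = rank M Y + card (Z - Y)"
    using J assms by (subst card_Un_disjoint) (auto intro: finite_indep)
  ultimately have "?K \<in> indeps M"
    using rank_eq_card_iff_M[of ?K] assms J finite_indep by auto
  then show ?thesis by (rule indeps_down) (use J assms in auto)
qed

end

section \<open>Fundamental circuits of a basis\<close>

locale based_matroid = matroid +
  fixes B0
  assumes basis_B0: "basis M B0"
begin

abbreviation R where "R \<equiv> ground M - B0"
abbreviation C where "C \<equiv> fundamental_circuit M B0"
abbreviation A where "A \<equiv> A_set M B0"
abbreviation U where "U \<equiv> U_set M B0"

lemma B0_indep: "B0 \<in> indeps M"
  using basis_B0 unfolding basis_def by blast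

lemma B0_subset: "B0 \<subseteq> ground M"
  using B0_indep indeps_subset by blast

lemma finite_B0: "finite B0"
  using B0_subset finite_ground finite_subset by blast

lemma finite_R: "finite R"
  using finite_ground by blast

lemma insert_B0_dependent: "i \<in> R \<Longrightarrow> insert i B0 \<notin> indeps M"
  using basis_B0 unfolding basis_def by blast

lemma rank_B0_subset: "X \<subseteq> B0 \<Longrightarrow> rank M X = card X"
  using B0_indep indeps_down finite_B0 finite_subset rank_eq_card_iff_M by metis

lemma rank_insert_B0: "i \<in> R \<Longrightarrow> rank M (insert i B0) = card B0"
proof -
  assume i: "i \<in> R"
  have "rank M (insert i B0) \<noteq> card (insert i B0)"
    using rank_eq_card_iff_M[of "insert i B0"] insert_B0_dependent[OF i] finite_B0 by simp
  moreover have "card (insert i B0) = Suc (card B0)" using i finite_B0 by simp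
  ultimately show ?thesis
    using rank_insert_le[of i B0] rank_insert_ge[of B0 i] rank_B0_subset[of B0] by auto
qed

lemma apex_in_circuit:
  assumes "circuit M D" "D \<subseteq> B0 \<union> {i}"
  shows "i \<in> D"
proof (rule ccontr)
  assume "i \<notin> D"
  then have "D \<subseteq> B0" using assms by auto
  then have "D \<in> indeps M" using B0_indep indeps_down by simp
  then show False using assms by (auto simp: circuit_def)
qed

text \<open>A minimal dependent subset of \<open>B0 \<union> {i}\<close> is a circuit. For uniqueness, let \<open>e\<close> lie in one circuit
  but not in the other: a basis of \<open>B0 \<union> {i}\<close> containing the rest of the first circuit must omit
  exactly \<open>e\<close>, and then it contains the second circuit.\<close>

lemma ex1_fundamental_circuit:
  assumes "i \<in> R"
  shows "\<exists>!C. circuit M C \<and> C \<subseteq> B0 \<union> {i}"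
proof (rule ex_ex1I)
  let ?D = "{D. D \<subseteq> insert i B0 \<and> D \<notin> indeps M}"
  have "finite ?D" "insert i B0 \<in> ?D"
    using finite_B0 insert_B0_dependent[OF assms] by auto
  then obtain D where D: "D \<in> ?D" "\<And>D'. D' \<in> ?D \<Longrightarrow> D' \<subseteq> D \<Longrightarrow> D = D'"
    using finite_has_minimal2 by (metis (no_types, lifting))
  have "circuit M D" unfolding circuit_def
  proof (intro conjI allI impI)
    show "D \<subseteq> ground M" using D(1) B0_subset assms by auto
    show "D \<notin> indeps M" using D by auto
    fix D' assume "D' \<subset> D"
    then show "D' \<in> indeps M" using D by blast
  qed
  then show "\<exists>C. circuit M C \<and> C \<subseteq> B0 \<union> {i}" using D by auto
next
  fix D D' assume D: "circuit M D \<and> D \<subseteq> B0 \<union> {i}" and D': "circuit M D' \<and> D' \<subseteq> B0 \<union> {i}"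
  show "D = D'"
  proof (rule ccontr)
    assume "D \<noteq> D'"
    then obtain e where e: "e \<in> D" "e \<notin> D'"
      using D D' unfolding circuit_def by (metis (no_types) psubsetI subsetI)
    then have ne: "e \<noteq> i" using apex_in_circuit D' by auto
    have "D - {e} \<in> indeps M" using D e unfolding circuit_def by auto
    then obtain J where J: "J \<in> indeps M" "D - {e} \<subseteq> J" "J \<subseteq> insert i B0"
        "card J = rank M (insert i B0)"
      using extend_indep[of "D - {e}" "insert i B0"] D by auto
    have "D \<notin> indeps M" using D by (auto simp: circuit_def)
    then have eJ: "e \<notin> J" using J indeps_down[OF J(1), of D] by auto
    have "e \<in> insert i B0" using D e by auto
    then have "J \<subseteq> insert i B0 - {e}" "card (insert i B0 - {e}) = card J"
      using J eJ rank_insert_B0[OF assms] assms finite_B0 by auto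
    then have "J = insert i B0 - {e}" using finite_B0 by (intro card_subset_eq) auto
    then have "D' \<subseteq> J" using e D' by auto
    then have "D' \<in> indeps M" using J indeps_down by blast
    then show False using D' by (auto simp: circuit_def)
  qed
qed

lemma
  assumes "i \<in> R"
  shows circuit_C: "circuit M (C i)" and C_subset: "C i \<subseteq> insert i B0" and self_in_C: "i \<in> C i"
proof -
  have *: "circuit M (C i) \<and> C i \<subseteq> B0 \<union> {i}"
    unfolding fundamental_circuit_def by (rule theI'[OF ex1_fundamental_circuit[OF assms]])
  then show "circuit M (C i)" "C i \<subseteq> insert i B0" by auto
  show "i \<in> C i"
    using * apex_in_circuit by blast
qed

lemma C_ground: "i \<in> R \<Longrightarrow> C i \<subseteq> ground M"
  using circuit_C unfolding circuit_def by blast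

lemma circuit_spans:
  assumes "circuit M D" "e \<in> D" "D - {e} \<subseteq> X"
  shows "rank M (insert e X) = rank M X"
proof (rule spanned_mono[of e "D - {e}"])
  have fin: "finite D" using assms finite_ground finite_subset unfolding circuit_def by blast
  have "D - {e} \<in> indeps M" "D \<notin> indeps M" using assms unfolding circuit_def by auto
  then have "rank M (D - {e}) = card D - 1" "rank M D \<noteq> card D"
    using rank_eq_card_iff_M[of "D - {e}"] rank_eq_card_iff_M[of D] fin assms by auto
  moreover have "rank M D \<le> card D" using fin by (rule rank_le_card_M)
  moreover have "rank M (D - {e}) \<le> rank M D" by (rule rank_mono) auto
  moreover have "card D > 0" using fin assms by (auto simp: card_gt_0_iff)
  moreover have "insert e (D - {e}) = D" using assms by auto
  ultimately show "rank M (insert e (D - {e})) = rank M (D - {e})" by simp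
qed (use assms in auto)

lemma A_eq: "\<tau> \<subseteq> R \<Longrightarrow> A \<tau> = (\<Union>i\<in>\<tau>. C i)"
proof -
  assume t: "\<tau> \<subseteq> R"
  then have "finite \<tau>" using finite_R finite_subset by blast
  then show ?thesis
    unfolding A_set_def mult_def using t C_ground
    by (auto simp: Suc_le_eq card_gt_0_iff)
qed

lemma U_iff: "\<tau> \<subseteq> R \<Longrightarrow> e \<in> U \<tau> \<longleftrightarrow> (\<exists>!i. i \<in> \<tau> \<and> e \<in> C i)"
proof -
  assume t: "\<tau> \<subseteq> R"
  have "mult M B0 \<tau> e = 1 \<longleftrightarrow> (\<exists>i. {i \<in> \<tau>. e \<in> C i} = {i})"
    unfolding mult_def by (simp add: card_1_singleton_iff)
  also have "\<dots> \<longleftrightarrow> (\<exists>!i. i \<in> \<tau> \<and> e \<in> C i)" by (simp add: set_eq_iff) metis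
  finally show ?thesis unfolding U_set_def using t C_ground by auto
qed

lemma U_unique:
  assumes "\<tau> \<subseteq> R" "e \<in> U \<tau>" "i \<in> \<tau>" "e \<in> C i" "j \<in> \<tau>" "e \<in> C j"
  shows "i = j"
  using U_iff[OF assms(1)] assms(2-) by metis

lemma U_memI:
  assumes "\<tau> \<subseteq> R" "i \<in> \<tau>" "e \<in> C i" "\<And>j. j \<in> \<tau> \<Longrightarrow> e \<in> C j \<Longrightarrow> j = i"
  shows "e \<in> U \<tau>"
  unfolding U_iff[OF assms(1)] using assms(2-) by blast

lemma U_memE:
  assumes "\<tau> \<subseteq> R" "e \<in> U \<tau>"
  obtains i where "i \<in> \<tau>" "e \<in> C i"
  using U_iff[OF assms(1)] assms(2) by metis

lemma A_ground: "A \<tau> \<subseteq> ground M" unfolding A_set_def by auto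
lemma finite_A: "finite (A \<tau>)" using A_ground finite_ground finite_subset by blast
lemma U_subset_A: "U \<tau> \<subseteq> A \<tau>" unfolding A_set_def U_set_def by auto
lemma A_mono: "\<tau> \<subseteq> \<sigma> \<Longrightarrow> \<sigma> \<subseteq> R \<Longrightarrow> A \<tau> \<subseteq> A \<sigma>" by (subst (1 2) A_eq) auto
lemma A_empty [simp]: "A {} = {}" using A_eq[of "{}"] by simp
lemma U_empty [simp]: "U {} = {}" using U_iff[of "{}"] by auto

text \<open>The basis elements in \<open>A \<tau>\<close> span it, because each \<open>i \<in> \<tau>\<close> is spanned by the rest of its circuit.
  So the corank of \<open>A \<tau>\<close> is the number of circuits, however they overlap.\<close>

lemma rank_A: 
  assumes "\<tau> \<subseteq> R" shows "rank M (A \<tau>) + card \<tau> = card (A \<tau>)"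
proof -
  have fin: "finite \<tau>" using assms finite_R finite_subset by blast
  have A: "A \<tau> = (A \<tau> \<inter> B0) \<union> \<tau>" 
    using A_eq[OF assms] C_subset self_in_C assms by fastforce
  have "rank M ((A \<tau> \<inter> B0) \<union> \<tau>) = rank M (A \<tau> \<inter> B0)"
  proof (rule rank_Un_spanned[OF fin])
    fix i assume i: "i \<in> \<tau>"
    then have iR: "i \<in> R" using assms by auto
    show "rank M (insert i (A \<tau> \<inter> B0)) = rank M (A \<tau> \<inter> B0)"
      by (rule circuit_spans[OF circuit_C[OF iR] self_in_C[OF iR]])
        (use C_subset[OF iR] A_eq[OF assms] i in auto)
  qed
  then have "rank M (A \<tau>) = card (A \<tau> \<inter> B0)" using A rank_B0_subset by simp
  moreover have "card (A \<tau>) = card (A \<tau> \<inter> B0) + card \<tau>"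
    using A assms fin finite_B0 by (subst A, subst card_Un_disjoint) auto
  ultimately show ?thesis by simp
qed

lemma rank_A_remove:
  assumes "\<tau> \<subseteq> R" "e \<in> A \<tau>"
  shows "rank M (A \<tau> - {e}) = rank M (A \<tau>)"
proof -
  obtain i where i: "i \<in> \<tau>" "e \<in> C i" using assms A_eq by auto
  then have "rank M (insert e (A \<tau> - {e})) = rank M (A \<tau> - {e})"
    by (intro circuit_spans[OF circuit_C[of i]]) (use assms A_eq[OF assms(1)] in auto)
  then show ?thesis using assms by (simp add: insert_absorb)
qed

lemma rank_ground: "rank M (ground M) = card B0"
proof -
  have "rank M (B0 \<union> R) = rank M B0"
    by (rule rank_Un_spanned[OF finite_R]) (simp add: rank_insert_B0 rank_B0_subset)
  moreover have "B0 \<union> R = ground M" using B0_subset by auto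
  ultimately show ?thesis using rank_B0_subset[of B0] by simp
qed

lemma card_ground: "card (ground M) = card B0 + card R"
  by (metis B0_subset card_Diff_subset card_mono finite_B0 finite_ground le_add_diff_inverse)

text \<open>Elements outside every fundamental circuit are coloops of \<open>M\<close>.\<close>

lemma indep_iff_indep_A:
  assumes "X \<subseteq> ground M"
  shows "X \<inter> A R \<in> indeps M \<longleftrightarrow> X \<in> indeps M"
proof
  assume ind: "X \<inter> A R \<in> indeps M"
  show "X \<in> indeps M"
  proof (rule coloop_extension[OF finite_ground A_ground _ assms ind])
    have "card (ground M - A R) = card (ground M) - card (A R)" "card (A R) \<le> card (ground M)"
      using A_ground finite_A finite_ground by (auto simp: card_Diff_subset card_mono)
    then show "rank M (ground M) = rank M (A R) + card (ground M - A R)"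
      using rank_A[of R] rank_ground card_ground by simp
  qed
qed (use indeps_down in blast)

text \<open>Adjoining the circuit of \<open>i\<close> to \<open>A \<tau>\<close> raises the corank by one, and removing the private element \<open>e\<close>
  of that circuit lowers it again. Hence all elements of \<open>A (insert i \<tau>) - {e}\<close> outside \<open>A \<tau>\<close> are
  coloops there and do not affect independence.\<close>

lemma indep_insert_private:
  assumes "\<tau> \<subseteq> R" "i \<in> R" "e \<in> C i" "e \<notin> A \<tau>" "e \<notin> X"
  shows "X \<inter> A (insert i \<tau>) \<in> indeps M \<longleftrightarrow> X \<inter> A \<tau> \<in> indeps M"
proof
  have sub: "A \<tau> \<subseteq> A (insert i \<tau>)" using assms by (intro A_mono) auto
  show "X \<inter> A \<tau> \<in> indeps M" if "X \<inter> A (insert i \<tau>) \<in> indeps M"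
    using that indeps_down sub by (metis inf_mono order_refl)
  assume ind: "X \<inter> A \<tau> \<in> indeps M"
  let ?Z = "A (insert i \<tau>) - {e}"
  have eA: "e \<in> A (insert i \<tau>)" using assms A_eq[of "insert i \<tau>"] by auto
  have i: "i \<notin> \<tau>" using assms A_eq by auto
  show "X \<inter> A (insert i \<tau>) \<in> indeps M"
  proof (rule coloop_extension[of ?Z "A \<tau>"])
    show "finite ?Z" "A \<tau> \<subseteq> ?Z" using finite_A sub assms by auto
    have "rank M ?Z = rank M (A (insert i \<tau>))" using rank_A_remove eA assms by simp
    moreover have "rank M (A (insert i \<tau>)) + Suc (card \<tau>) = card (A (insert i \<tau>))"
      using rank_A[of "insert i \<tau>"] assms i finite_R finite_subset[of \<tau> R] by simp
    moreover have "card (?Z - A \<tau>) = card ?Z - card (A \<tau>)" "card (A \<tau>) \<le> card ?Z"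
      using \<open>A \<tau> \<subseteq> ?Z\<close> finite_A by (auto intro!: card_Diff_subset card_mono)
    moreover have "card ?Z = card (A (insert i \<tau>)) - 1" using eA finite_A by simp
    ultimately show "rank M ?Z = rank M (A \<tau>) + card (?Z - A \<tau>)"
      using rank_A[OF assms(1)] by linarith
    show "X \<inter> A (insert i \<tau>) \<subseteq> ?Z" using assms by auto
    have "X \<inter> A (insert i \<tau>) \<inter> A \<tau> = X \<inter> A \<tau>" using sub by auto
    then show "X \<inter> A (insert i \<tau>) \<inter> A \<tau> \<in> indeps M" using ind by simp
  qed
qed

end


section \<open>The \<open>h\<close>-vector as a generating function\<close>

unbundle fps_syntax

text \<open>At \<open>y = 1\<close> the factor \<open>(y - 1) ^ (card X - rank N X)\<close> kills every dependent set \<open>X\<close>. This holds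
  for any family of subsets of a finite ground set that contains the empty set, and it is applied in this
  form to the dead nodes.\<close>

lemma poly_tutte_1:
  assumes fin: "finite (ground N)" and sub: "indeps N \<subseteq> Pow (ground N)" and emp: "{} \<in> indeps N"
  shows "poly (tutte N) 1 = (\<Sum>I\<in>indeps N. [:-1, 1:] ^ (rank N (ground N) - card I))"
proof -
  let ?d = "rank N (ground N)"
  have finI: "finite (indeps N)" using fin sub finite_subset by blast
  have "poly (tutte N) 1 =
      (\<Sum>X\<in>Pow (ground N). [:-1, 1:] ^ (?d - rank N X) * 0 ^ (card X - rank N X))"
    by (simp add: tutte_def poly_sum)
  also have "\<dots> = (\<Sum>I\<in>indeps N. [:-1, 1:] ^ (?d - card I))"
  proof (rule sum.mono_neutral_cong_right)
    show "\<forall>X\<in>Pow (ground N) - indeps N. [:-1, 1::int:] ^ (?d - rank N X) * 0 ^ (card X - rank N X) = 0"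
    proof
      fix X assume X: "X \<in> Pow (ground N) - indeps N"
      then have "finite X" using fin finite_subset by blast
      then have "rank N X < card X"
        using rank_eq_card_iff[OF finI emp] rank_le_card[OF finI emp] X by (simp add: le_neq_trans)
      then show "[:-1, 1::int:] ^ (?d - rank N X) * 0 ^ (card X - rank N X) = 0" by simp
    qed
    fix I assume "I \<in> indeps N"
    moreover from this have "finite I" using fin sub finite_subset by blast
    ultimately have "rank N I = card I" using rank_eq_card_iff[OF finI emp] by simp
    then show "[:-1, 1::int:] ^ (?d - rank N I) * 0 ^ (card I - rank N I) = [:-1, 1:] ^ (?d - card I)"
      by simp
  qed (use fin sub in auto)
  finally show ?thesis .
qed

lemma h_vector_nth:
  assumes fin: "finite (ground N)" and sub: "indeps N \<subseteq> Pow (ground N)" and emp: "{} \<in> indeps N"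
  defines "d \<equiv> rank N (ground N)"
  shows "h_vector N k = (\<Sum>I\<in>indeps N. fps_X ^ card I * (1 - fps_X) ^ (d - card I)) $ k"
proof -
  have finI: "finite (indeps N)" using fin sub finite_subset by blast
  have le: "card I \<le> d" if "I \<in> indeps N" for I
    unfolding d_def using card_le_rank[OF finI that] that sub by auto
  have T: "poly (tutte N) 1 = (\<Sum>I\<in>indeps N. [:-1, 1:] ^ (d - card I))"
    unfolding d_def by (rule poly_tutte_1[OF fin sub emp])
  \<comment> \<open>Reversing coefficients turns \<open>x - 1\<close> into \<open>1 - X\<close>.\<close>
  have rev: "((1 - fps_X) ^ m :: int fps) $ n = (if n \<le> m then coeff ([:-1, 1:] ^ m) (m - n) else 0)"
    for m n
  proof -
    have "(1 - fps_X :: int fps) = fps_of_poly (reflect_poly [:-1, 1:])"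
      by (simp add: reflect_poly_def fps_of_poly_pCons)
    then have "((1 - fps_X) ^ m :: int fps) = fps_of_poly (reflect_poly ([:-1, 1:] ^ m))"
      by (simp only: fps_of_poly_power reflect_poly_power)
    then have "((1 - fps_X) ^ m :: int fps) $ n = coeff (reflect_poly ([:-1, 1:] ^ m)) n"
      by (simp only: fps_of_poly_nth)
    then show ?thesis
      by (simp only: coeff_reflect_poly degree_linear_power) auto
  qed
  have summand: "(fps_X ^ card I * (1 - fps_X) ^ (d - card I) :: int fps) $ k =
      (if k \<le> d then coeff ([:-1, 1:] ^ (d - card I)) (d - k) else 0)" if "I \<in> indeps N" for I
  proof -
    have "coeff ([:-1, 1::int:] ^ (d - card I)) (d - k) = 0" if "k < card I"
      by (rule coeff_eq_0) (use le[OF \<open>I \<in> indeps N\<close>] that in \<open>simp add: degree_linear_power\<close>)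
    then show ?thesis
      using le[OF that] by (auto simp: fps_X_power_mult_nth rev not_less)
  qed
  have "h_vector N k = (\<Sum>I\<in>indeps N. if k \<le> d then coeff ([:-1, 1:] ^ (d - card I)) (d - k) else 0)"
    unfolding h_vector_def Let_def T by (simp add: d_def coeff_sum)
  also have "\<dots> = (\<Sum>I\<in>indeps N. (fps_X ^ card I * (1 - fps_X) ^ (d - card I)) $ k)"
    by (rule sum.cong) (simp_all only: summand)
  finally show ?thesis by (simp add: fps_sum_nth)
qed

definition h_gf :: "'a indep_structure \<Rightarrow> int fps" where
  "h_gf N = Abs_fps (h_vector N)"

lemma h_gf_eq:
  assumes "finite (ground N)" "indeps N \<subseteq> Pow (ground N)" "{} \<in> indeps N"
  shows "h_gf N = (\<Sum>I\<in>indeps N. fps_X ^ card I * (1 - fps_X) ^ (rank N (ground N) - card I))"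
  by (rule fps_ext) (simp add: h_gf_def h_vector_nth[OF assms])

lemma h_vector_top:
  assumes "finite (ground N)" "indeps N \<subseteq> Pow (ground N)" "{} \<in> indeps N"
  shows "h_vector N (rank N (ground N)) = (\<Sum>I\<in>indeps N. (-1) ^ (rank N (ground N) - card I))"
  by (simp add: h_vector_def poly_tutte_1[OF assms] coeff_sum coeff_0_power)


section \<open>Degree generating functions of sets of monomials\<close>

definition degree_gf :: "('v \<Rightarrow> nat) set \<Rightarrow> int fps" where
  "degree_gf S = Abs_fps (degree_sequence S)"

lemma degree_gf_nth: "degree_gf S $ k = int (card {a \<in> S. total_degree a = k})"
  by (simp add: degree_gf_def degree_sequence_def)

lemma total_degree_eq_sum:
  assumes "a \<in> exponents V" "finite V"
  shows "total_degree a = sum a V"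
  unfolding total_degree_def
  by (rule sum.mono_neutral_left) (use assms in \<open>auto simp: exponents_def\<close>)

lemma exponents_mono: "V \<subseteq> W \<Longrightarrow> exponents V \<subseteq> exponents W"
  unfolding exponents_def by auto

lemma finite_support: "a \<in> exponents V \<Longrightarrow> finite V \<Longrightarrow> finite {i. a i \<noteq> 0}"
  by (rule finite_subset[of _ V]) (auto simp: exponents_def)

lemma exponents_downward: "a \<in> exponents V \<Longrightarrow> c \<le> a \<Longrightarrow> c \<in> exponents V"
  by (simp add: exponents_def le_fun_def) (metis le_zero_eq)

lemma exponents_plus: "a \<in> exponents V \<Longrightarrow> b \<in> exponents V \<Longrightarrow> (\<lambda>i. a i + b i) \<in> exponents V"
  unfolding exponents_def by auto

lemma total_degree_plus:
  assumes "a \<in> exponents V" "b \<in> exponents V" "finite V"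
  shows "total_degree (\<lambda>i. a i + b i) = total_degree a + total_degree b"
  using assms exponents_plus[OF assms(1,2)] by (simp add: total_degree_eq_sum sum.distrib)

lemma total_degree_mono:
  assumes "a \<in> exponents V" "b \<in> exponents V" "finite V" "a \<le> b"
  shows "total_degree a \<le> total_degree b"
  using assms by (simp add: total_degree_eq_sum le_fun_def sum_mono)

lemma eq_if_le_same_degree:
  assumes "a \<in> exponents V" "b \<in> exponents V" "finite V" "a \<le> b" "total_degree a = total_degree b"
  shows "a = b"
proof
  fix i
  show "a i = b i"
  proof (cases "i \<in> V")
    case True
    then show ?thesis
      using sum_mono_inv[of a V b i] assms by (simp add: total_degree_eq_sum le_fun_def)
  qed (use assms in \<open>simp add: exponents_def\<close>)
qed

lemma finite_exponents_degree:
  assumes "finite V" shows "finite {a \<in> exponents V. total_degree a = k}"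
proof (rule finite_subset)
  show "finite {a. \<forall>i. (i \<in> V \<longrightarrow> a i \<in> {..k}) \<and> (i \<notin> V \<longrightarrow> a i = 0)}"
    using assms by (intro finite_set_of_finite_funs) auto
  show "{a \<in> exponents V. total_degree a = k} \<subseteq>
      {a. \<forall>i. (i \<in> V \<longrightarrow> a i \<in> {..k}) \<and> (i \<notin> V \<longrightarrow> a i = 0)}"
    using assms by (auto simp: total_degree_eq_sum exponents_def intro: member_le_sum)
qed

lemma finite_degree_part:
  assumes "S \<subseteq> exponents V" "finite V" shows "finite {a \<in> S. total_degree a = k}"
  by (rule finite_subset[OF _ finite_exponents_degree[OF assms(2), of k]]) (use assms in auto)

definition sumset :: "('v \<Rightarrow> nat) set \<Rightarrow> ('v \<Rightarrow> nat) set \<Rightarrow> ('v \<Rightarrow> nat) set" where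
  "sumset S T = (\<lambda>(a, b) i. a i + b i) ` (S \<times> T)"

lemma sumset_subset_exponents:
  "S \<subseteq> exponents V \<Longrightarrow> T \<subseteq> exponents V \<Longrightarrow> sumset S T \<subseteq> exponents V"
  unfolding sumset_def by (auto intro!: exponents_plus)

text \<open>The product rule. It is stated for arbitrary injective sums rather than for disjoint sets of
  variables, because a shift by a fixed vector is then the special case of a singleton.\<close>

lemma degree_gf_sumset:
  assumes V: "finite V" and S: "S \<subseteq> exponents V" and T: "T \<subseteq> exponents V"
    and inj: "inj_on (\<lambda>(a, b) i. a i + b i) (S \<times> T)"
  shows "degree_gf (sumset S T) = degree_gf S * degree_gf T"
proof (rule fps_ext)
  fix k
  let ?part = "\<lambda>S k. {a \<in> S. total_degree a = k}"
  let ?add = "\<lambda>(a, b) i. a i + b i :: nat"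
  have "?part (sumset S T) k = ?add ` (\<Union>j\<in>{0..k}. ?part S j \<times> ?part T (k - j))"
  proof -
    have "total_degree (\<lambda>i. a i + b i) = total_degree a + total_degree b" if "a \<in> S" "b \<in> T" for a b
      using that S T V total_degree_plus by blast
    then show ?thesis unfolding sumset_def by force
  qed
  also have "card \<dots> = card (\<Union>j\<in>{0..k}. ?part S j \<times> ?part T (k - j))"
    by (rule card_image) (rule inj_on_subset[OF inj], auto)
  also have "\<dots> = (\<Sum>j=0..k. card (?part S j \<times> ?part T (k - j)))"
    by (rule card_UN_disjoint)
      (use finite_degree_part[OF S V] finite_degree_part[OF T V] in auto)
  finally show "degree_gf (sumset S T) $ k = (degree_gf S * degree_gf T) $ k"
    by (simp add: degree_gf_nth fps_mult_nth card_cartesian_product)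
qed

lemma degree_gf_singleton: "degree_gf {b} = fps_X ^ total_degree b"
proof (rule fps_ext)
  fix k
  have "{a \<in> {b}. total_degree a = k} = (if total_degree b = k then {b} else {})" by auto
  then show "degree_gf {b} $ k = (fps_X ^ total_degree b) $ k"
    by (auto simp: degree_gf_nth)
qed

lemma degree_gf_UN:
  assumes "finite V" "finite J" "\<And>j. j \<in> J \<Longrightarrow> S j \<subseteq> exponents V"
    and "\<And>i j. i \<in> J \<Longrightarrow> j \<in> J \<Longrightarrow> i \<noteq> j \<Longrightarrow> S i \<inter> S j = {}"
  shows "degree_gf (\<Union>j\<in>J. S j) = (\<Sum>j\<in>J. degree_gf (S j))"
proof (rule fps_ext)
  fix k
  have "{a \<in> \<Union>j\<in>J. S j. total_degree a = k} = (\<Union>j\<in>J. {a \<in> S j. total_degree a = k})" by auto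
  also have "card \<dots> = (\<Sum>j\<in>J. card {a \<in> S j. total_degree a = k})"
    by (rule card_UN_disjoint) (use assms finite_degree_part[OF assms(3) assms(1)] in blast)+
  finally show "degree_gf (\<Union>j\<in>J. S j) $ k = (\<Sum>j\<in>J. degree_gf (S j)) $ k"
    by (simp add: degree_gf_nth fps_sum_nth)
qed

lemma exponents_empty: "exponents {} = {\<lambda>_. 0}"
  unfolding exponents_def by auto

lemma total_degree_zero [simp]: "total_degree (\<lambda>_. 0) = 0"
  by (simp add: total_degree_def)

text \<open>This is \<open>1 / (1 - X) ^ card V\<close>, the Hilbert series of a polynomial ring, written without division.\<close>

lemma degree_gf_exponents:
  assumes "finite V"
  shows "(1 - fps_X) ^ card V * degree_gf (exponents V) = 1"
  using assms
proof (induction V)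
  case empty
  show ?case by (simp add: exponents_empty degree_gf_singleton)
next
  case (insert v V)
  have one: "degree_gf (exponents {v}) = Abs_fps (\<lambda>_. 1)"
  proof (rule fps_ext)
    fix k
    have "{a \<in> exponents {v}. total_degree a = k} = {(\<lambda>_. 0)(v := k)}"
      by (auto simp: total_degree_eq_sum[of _ "{v}"] exponents_def)
    then show "degree_gf (exponents {v}) $ k = Abs_fps (\<lambda>_. 1) $ k"
      by (simp add: degree_gf_nth)
  qed
  have "exponents (insert v V) = sumset (exponents {v}) (exponents V)"
  proof
    show "sumset (exponents {v}) (exponents V) \<subseteq> exponents (insert v V)"
      by (intro sumset_subset_exponents exponents_mono) auto
    show "exponents (insert v V) \<subseteq> sumset (exponents {v}) (exponents V)"
    proof
      fix a assume "a \<in> exponents (insert v V)"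
      then have "(\<lambda>_. 0)(v := a v) \<in> exponents {v}" "a(v := 0) \<in> exponents V"
          "a = (\<lambda>i. ((\<lambda>_. 0)(v := a v)) i + (a(v := 0)) i)"
        by (auto simp: exponents_def)
      then show "a \<in> sumset (exponents {v}) (exponents V)"
        unfolding sumset_def by (intro image_eqI[of _ _ "((\<lambda>_. 0)(v := a v), a(v := 0))"]) auto
    qed
  qed
  moreover have "degree_gf (sumset (exponents {v}) (exponents V)) =
      degree_gf (exponents {v}) * degree_gf (exponents V)"
  proof (rule degree_gf_sumset[where V = "insert v V"])
    show "inj_on (\<lambda>(a, b) i. a i + b i) (exponents {v} \<times> exponents V)"
    proof (rule inj_onI, clarify)
      fix a b a' b'
      assume ab: "a \<in> exponents {v}" "b \<in> exponents V" "a' \<in> exponents {v}" "b' \<in> exponents V"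
        and eq: "(\<lambda>i. a i + b i) = (\<lambda>i. a' i + b' i)"
      have "a i = a' i \<and> b i = b' i" for i
        using fun_cong[OF eq, of i] ab insert.hyps by (cases "i = v") (auto simp: exponents_def)
      then show "a = a' \<and> b = b'" by auto
    qed
  qed (use insert.hyps in \<open>auto intro: exponents_mono[THEN subsetD]\<close>)
  moreover have "(1 - fps_X) * Abs_fps (\<lambda>_. 1 :: int) = 1"
    by (rule fps_ext) (simp add: left_diff_distrib)
  ultimately show ?case
    using insert by (simp add: one mult_ac)
qed


section \<open>Splitting at the largest stratum that can be fired\<close>

context based_matroid
begin

abbreviation b where "b \<equiv> baseline M B0"

text \<open>An element covered only once by the larger stratum is covered only once by the smaller one.\<close>

lemma baseline_antimono:
  assumes "\<sigma> \<subseteq> \<tau>" "\<tau> \<subseteq> R" "i \<in> \<sigma>"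
  shows "b \<tau> i \<le> b \<sigma> i"
proof -
  have "i \<in> \<tau>" "i \<in> R" "\<sigma> \<subseteq> R" using assms by auto
  have "C i \<inter> U \<tau> \<subseteq> C i \<inter> U \<sigma>"
  proof
    fix e assume e: "e \<in> C i \<inter> U \<tau>"
    have "e \<in> U \<sigma>"
    proof (rule U_memI[OF \<open>\<sigma> \<subseteq> R\<close> assms(3)])
      show "e \<in> C i" using e by simp
      show "j = i" if "j \<in> \<sigma>" "e \<in> C j" for j
        using U_unique[OF \<open>\<tau> \<subseteq> R\<close>, of e j i] e that assms by auto
    qed
    then show "e \<in> C i \<inter> U \<sigma>" using e by simp
  qed
  moreover have "finite (C i)"
    using C_ground[OF \<open>i \<in> R\<close>] finite_ground finite_subset by blast
  ultimately show ?thesis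
    unfolding baseline_def using assms \<open>i \<in> \<tau>\<close> by (auto intro: card_mono)
qed

text \<open>Each element of \<open>U \<rho>\<close> lies in the circuit of exactly one \<open>i \<in> \<rho>\<close>, and it is outside \<open>A \<sigma>\<close> iff
  that \<open>i\<close> is outside \<open>\<sigma>\<close>.\<close>

lemma sum_baseline:
  assumes "\<sigma> \<subseteq> \<rho>" "\<rho> \<subseteq> R"
  shows "(\<Sum>i\<in>\<rho> - \<sigma>. b \<rho> i) = card (U \<rho> - A \<sigma>)"
proof -
  have sR: "\<sigma> \<subseteq> R" using assms by auto
  have "U \<rho> - A \<sigma> = (\<Union>i\<in>\<rho> - \<sigma>. C i \<inter> U \<rho>)"
  proof (intro equalityI subsetI)
    fix e assume e: "e \<in> U \<rho> - A \<sigma>"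
    then obtain i where "i \<in> \<rho>" "e \<in> C i" using U_memE[OF assms(2)] by auto
    then show "e \<in> (\<Union>i\<in>\<rho> - \<sigma>. C i \<inter> U \<rho>)" using e A_eq[OF sR] by auto
  next
    fix e assume "e \<in> (\<Union>i\<in>\<rho> - \<sigma>. C i \<inter> U \<rho>)"
    then obtain i where i: "i \<in> \<rho> - \<sigma>" "e \<in> C i" "e \<in> U \<rho>" by auto
    have "e \<notin> A \<sigma>"
      using U_unique[OF assms(2) i(3), of i] i A_eq[OF sR] assms(1) by auto
    then show "e \<in> U \<rho> - A \<sigma>" using i by auto
  qed
  also have "card \<dots> = (\<Sum>i\<in>\<rho> - \<sigma>. card (C i \<inter> U \<rho>))"
  proof (rule card_UN_disjoint)
    show "finite (\<rho> - \<sigma>)" using assms finite_R finite_subset by blast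
    show "\<forall>i\<in>\<rho> - \<sigma>. finite (C i \<inter> U \<rho>)"
      using finite_subset[OF U_subset_A finite_A] by auto
    show "\<forall>i\<in>\<rho> - \<sigma>. \<forall>j\<in>\<rho> - \<sigma>. i \<noteq> j \<longrightarrow> C i \<inter> U \<rho> \<inter> (C j \<inter> U \<rho>) = {}"
      using U_unique[OF assms(2)] by auto
  qed
  finally show ?thesis by (simp add: baseline_def)
qed

text \<open>For \<open>T = R\<close> these are the vectors on \<open>R - \<rho>\<close> from which, once \<open>\<rho>\<close> has been fired, no larger
  stratum can be fired; they are the coparking functions of the contraction of \<open>A \<rho>\<close>. The second
  parameter exists for an induction that removes elements of \<open>T\<close> one at a time.\<close>

definition coparking :: "'a set \<Rightarrow> 'a set \<Rightarrow> ('a \<Rightarrow> nat) set" where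
  "coparking \<rho> T = {c \<in> exponents (T - \<rho>). \<forall>\<tau>. \<rho> \<subset> \<tau> \<longrightarrow> \<tau> \<subseteq> T \<longrightarrow> (\<exists>i\<in>\<tau> - \<rho>. c i < b \<tau> i)}"

text \<open>For \<open>\<sigma> = {}\<close> this is the largest stratum that can be fired from \<open>a\<close>, or the empty set. For general
  \<open>\<sigma>\<close> the elements of \<open>\<sigma>\<close> are treated as having unbounded supply, so that only \<open>R - \<sigma>\<close> matters.\<close>

definition max_fired :: "'a set \<Rightarrow> ('a \<Rightarrow> nat) \<Rightarrow> 'a set" where
  "max_fired \<sigma> a = \<Union> {\<rho>. \<sigma> \<subseteq> \<rho> \<and> \<rho> \<subseteq> R \<and> (\<forall>i\<in>\<rho> - \<sigma>. b \<rho> i \<le> a i)}"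

text \<open>The union of all admissible strata is itself admissible, because enlarging a stratum only lowers
  the baseline.\<close>

lemma max_fired_fires:
  assumes "\<sigma> \<subseteq> R"
  shows "\<sigma> \<subseteq> max_fired \<sigma> a" "max_fired \<sigma> a \<subseteq> R"
    and "i \<in> max_fired \<sigma> a - \<sigma> \<Longrightarrow> b (max_fired \<sigma> a) i \<le> a i"
proof -
  show "\<sigma> \<subseteq> max_fired \<sigma> a" unfolding max_fired_def using assms by auto
  show sub: "max_fired \<sigma> a \<subseteq> R" unfolding max_fired_def by auto
  assume "i \<in> max_fired \<sigma> a - \<sigma>"
  then obtain \<rho> where \<rho>: "i \<in> \<rho> - \<sigma>" "\<sigma> \<subseteq> \<rho>" "\<rho> \<subseteq> R" "\<forall>i\<in>\<rho> - \<sigma>. b \<rho> i \<le> a i"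
    unfolding max_fired_def by auto
  then have "\<rho> \<subseteq> max_fired \<sigma> a" unfolding max_fired_def by auto
  then have "b (max_fired \<sigma> a) i \<le> b \<rho> i" using baseline_antimono sub \<rho> by blast
  then show "b (max_fired \<sigma> a) i \<le> a i" using \<rho> by (meson order_trans)
qed

lemma max_fired_greatest:
  "\<sigma> \<subseteq> \<rho> \<Longrightarrow> \<rho> \<subseteq> R \<Longrightarrow> (\<And>i. i \<in> \<rho> - \<sigma> \<Longrightarrow> b \<rho> i \<le> a i) \<Longrightarrow> \<rho> \<subseteq> max_fired \<sigma> a"
  unfolding max_fired_def by auto

lemma max_fired_eq_iff:
  assumes "\<sigma> \<subseteq> \<rho>" "\<rho> \<subseteq> R" "a \<in> exponents (R - \<sigma>)"
  shows "max_fired \<sigma> a = \<rho> \<longleftrightarrow>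
    (\<forall>i\<in>\<rho> - \<sigma>. b \<rho> i \<le> a i) \<and> (\<lambda>i. if i \<in> \<rho> then 0 else a i) \<in> coparking \<rho> R"
proof
  have sR: "\<sigma> \<subseteq> R" using assms by auto
  note fires = max_fired_fires[OF sR, where a = a]
  show "(\<forall>i\<in>\<rho> - \<sigma>. b \<rho> i \<le> a i) \<and> (\<lambda>i. if i \<in> \<rho> then 0 else a i) \<in> coparking \<rho> R"
    if "max_fired \<sigma> a = \<rho>"
  proof
    show le: "\<forall>i\<in>\<rho> - \<sigma>. b \<rho> i \<le> a i" using fires(3) that by auto
    have "\<exists>i\<in>\<tau> - \<rho>. a i < b \<tau> i" if \<tau>: "\<rho> \<subset> \<tau>" "\<tau> \<subseteq> R" for \<tau>
    proof -
      have "\<not> (\<forall>i\<in>\<tau> - \<sigma>. b \<tau> i \<le> a i)"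
        using max_fired_greatest[of \<sigma> \<tau> a] \<tau> assms \<open>max_fired \<sigma> a = \<rho>\<close> by auto
      then obtain i where i: "i \<in> \<tau> - \<sigma>" "a i < b \<tau> i" by (auto simp: not_le)
      have "i \<notin> \<rho>"
      proof
        assume "i \<in> \<rho>"
        then have "b \<tau> i \<le> b \<rho> i" "b \<rho> i \<le> a i"
          using baseline_antimono[of \<rho> \<tau> i] \<tau> le i by auto
        then show False using i by simp
      qed
      then show ?thesis using i by auto
    qed
    then show "(\<lambda>i. if i \<in> \<rho> then 0 else a i) \<in> coparking \<rho> R"
      using assms unfolding coparking_def exponents_def by auto
  qed
  show "max_fired \<sigma> a = \<rho>"
    if h: "(\<forall>i\<in>\<rho> - \<sigma>. b \<rho> i \<le> a i) \<and> (\<lambda>i. if i \<in> \<rho> then 0 else a i) \<in> coparking \<rho> R"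
  proof (rule ccontr)
    assume ne: "max_fired \<sigma> a \<noteq> \<rho>"
    have "\<rho> \<subseteq> max_fired \<sigma> a" using h assms by (intro max_fired_greatest) auto
    then have "\<rho> \<subset> max_fired \<sigma> a" using ne by auto
    then have "\<exists>i\<in>max_fired \<sigma> a - \<rho>. (if i \<in> \<rho> then 0 else a i) < b (max_fired \<sigma> a) i"
      using h fires(2) unfolding coparking_def by blast
    then obtain i where "i \<in> max_fired \<sigma> a - \<rho>" "a i < b (max_fired \<sigma> a) i"
      by auto
    moreover from this have "i \<in> max_fired \<sigma> a - \<sigma>" using assms by auto
    ultimately show False using fires(3)[of i] by simp
  qed
qed

text \<open>The vectors on \<open>R - \<sigma>\<close> whose largest stratum above \<open>\<sigma>\<close> is \<open>\<rho>\<close>, with what remains on \<open>\<rho> - \<sigma>\<close>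
  after firing confined to \<open>X\<close>. With \<open>X\<close> the full orthant the cells partition \<open>\<nat>\<^bsup>R - \<sigma>\<^esup>\<close>;
  with \<open>\<sigma> = {}\<close> and \<open>X\<close> the fibres they partition the relaxed coparking functions.\<close>

definition cell :: "'a set \<Rightarrow> 'a set \<Rightarrow> ('a \<Rightarrow> nat) set \<Rightarrow> ('a \<Rightarrow> nat) set" where
  "cell \<sigma> \<rho> X = {a \<in> exponents (R - \<sigma>). max_fired \<sigma> a = \<rho> \<and>
     (\<lambda>i. if i \<in> \<rho> - \<sigma> then a i - b \<rho> i else 0) \<in> X}"

text \<open>Whether \<open>\<rho>\<close> is the largest stratum depends on the coordinates in \<open>\<rho>\<close> only through the inequality
  with the baseline, so the three summands can be chosen independently.\<close>

lemma cell_eq_sumset: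
  assumes "\<sigma> \<subseteq> \<rho>" "\<rho> \<subseteq> R" "X \<subseteq> exponents (\<rho> - \<sigma>)"
  shows "cell \<sigma> \<rho> X =
    sumset {\<lambda>i. if i \<in> \<rho> - \<sigma> then b \<rho> i else 0} (sumset X (coparking \<rho> R))"
    (is "_ = sumset {?\<beta>} _")
proof
  show "cell \<sigma> \<rho> X \<subseteq> sumset {?\<beta>} (sumset X (coparking \<rho> R))"
  proof
    fix a assume a: "a \<in> cell \<sigma> \<rho> X"
    let ?m = "\<lambda>i. if i \<in> \<rho> - \<sigma> then a i - b \<rho> i else 0"
    let ?c = "\<lambda>i. if i \<in> \<rho> then 0 else a i"
    have e: "a \<in> exponents (R - \<sigma>)" and m: "?m \<in> X" and "max_fired \<sigma> a = \<rho>"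
      using a unfolding cell_def by auto
    then have le: "\<forall>i\<in>\<rho> - \<sigma>. b \<rho> i \<le> a i" and c: "?c \<in> coparking \<rho> R"
      using max_fired_eq_iff[OF assms(1,2) e] by auto
    have "(\<lambda>i. ?m i + ?c i) \<in> sumset X (coparking \<rho> R)"
      unfolding sumset_def using m c by (intro image_eqI[of _ _ "(?m, ?c)"]) auto
    moreover have "a = (\<lambda>i. ?\<beta> i + (?m i + ?c i))"
      using e le by (auto simp: exponents_def fun_eq_iff)
    ultimately show "a \<in> sumset {?\<beta>} (sumset X (coparking \<rho> R))"
      unfolding sumset_def[of "{?\<beta>}"]
      by (intro image_eqI[of _ _ "(?\<beta>, \<lambda>i. ?m i + ?c i)"]) auto
  qed
  show "sumset {?\<beta>} (sumset X (coparking \<rho> R)) \<subseteq> cell \<sigma> \<rho> X"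
  proof
    fix a assume "a \<in> sumset {?\<beta>} (sumset X (coparking \<rho> R))"
    then obtain m c where m: "m \<in> X" and c: "c \<in> coparking \<rho> R"
      and a: "a = (\<lambda>i. ?\<beta> i + (m i + c i))"
      unfolding sumset_def by auto
    have m0: "m i = 0" if "i \<notin> \<rho> - \<sigma>" for i using m assms(3) that by (auto simp: exponents_def)
    have c0: "c i = 0" if "i \<notin> R - \<rho>" for i
      using c that by (auto simp: coparking_def exponents_def)
    have e: "a \<in> exponents (R - \<sigma>)" using m0 c0 assms by (auto simp: a exponents_def)
    have "(\<lambda>i. if i \<in> \<rho> then 0 else a i) = c" using m0 c0 by (auto simp: a fun_eq_iff)
    moreover have "\<forall>i\<in>\<rho> - \<sigma>. b \<rho> i \<le> a i" by (simp add: a)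
    ultimately have "max_fired \<sigma> a = \<rho>"
      using max_fired_eq_iff[OF assms(1,2) e] c by simp
    moreover have "(\<lambda>i. if i \<in> \<rho> - \<sigma> then a i - b \<rho> i else 0) = m"
      using m0 c0 by (auto simp: a fun_eq_iff)
    ultimately show "a \<in> cell \<sigma> \<rho> X" using e m by (simp add: cell_def)
  qed
qed

lemma degree_gf_cell:
  assumes "\<sigma> \<subseteq> \<rho>" "\<rho> \<subseteq> R" "X \<subseteq> exponents (\<rho> - \<sigma>)"
  shows "degree_gf (cell \<sigma> \<rho> X) =
    fps_X ^ card (U \<rho> - A \<sigma>) * degree_gf X * degree_gf (coparking \<rho> R)"
proof -
  let ?\<beta> = "\<lambda>i. if i \<in> \<rho> - \<sigma> then b \<rho> i else 0"
  have \<beta>: "?\<beta> \<in> exponents (\<rho> - \<sigma>)" by (simp add: exponents_def)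
  have fin: "finite (\<rho> - \<sigma>)" using assms finite_R finite_subset by blast
  have sub: "exponents (\<rho> - \<sigma>) \<subseteq> exponents R" using assms by (intro exponents_mono) auto
  have c: "coparking \<rho> R \<subseteq> exponents R"
    using exponents_mono[of "R - \<rho>" R] by (auto simp: coparking_def)
  have X: "X \<subseteq> exponents R" using assms sub by auto
  have "inj_on (\<lambda>(a, b) i. a i + b i) (X \<times> coparking \<rho> R)"
  proof (rule inj_onI, clarify)
    fix x y x' y'
    assume xy: "x \<in> X" "y \<in> coparking \<rho> R" "x' \<in> X" "y' \<in> coparking \<rho> R"
      and eq: "(\<lambda>i. x i + y i) = (\<lambda>i. x' i + y' i)"
    have e: "x \<in> exponents (\<rho> - \<sigma>)" "x' \<in> exponents (\<rho> - \<sigma>)"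
        "y \<in> exponents (R - \<rho>)" "y' \<in> exponents (R - \<rho>)"
      using xy assms(3) by (auto simp: coparking_def)
    have "x i = x' i \<and> y i = y' i" for i
      using fun_cong[OF eq, of i] e by (cases "i \<in> \<rho>") (auto simp: exponents_def)
    then show "x = x' \<and> y = y'" by auto
  qed
  then have "degree_gf (sumset X (coparking \<rho> R)) = degree_gf X * degree_gf (coparking \<rho> R)"
    using degree_gf_sumset[OF finite_R X c] by simp
  moreover have "degree_gf (sumset {?\<beta>} (sumset X (coparking \<rho> R))) =
      degree_gf {?\<beta>} * degree_gf (sumset X (coparking \<rho> R))"
  proof (rule degree_gf_sumset[OF finite_R])
    show "{?\<beta>} \<subseteq> exponents R" using \<beta> sub by auto
    show "sumset X (coparking \<rho> R) \<subseteq> exponents R" by (rule sumset_subset_exponents[OF X c])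
    show "inj_on (\<lambda>(a, b) i. a i + b i) ({?\<beta>} \<times> sumset X (coparking \<rho> R))"
      by (rule inj_onI) (auto simp: fun_eq_iff)
  qed
  moreover have "total_degree ?\<beta> = card (U \<rho> - A \<sigma>)"
    unfolding total_degree_eq_sum[OF \<beta> fin] sum_baseline[OF assms(1,2), symmetric] by simp
  ultimately show ?thesis
    unfolding cell_eq_sumset[OF assms] by (simp add: degree_gf_singleton mult.assoc)
qed

lemma cell_disjoint: "\<rho> \<noteq> \<rho>' \<Longrightarrow> cell \<sigma> \<rho> X \<inter> cell \<sigma> \<rho>' X' = {}"
  unfolding cell_def by auto

lemma cell_subset: "cell \<sigma> \<rho> X \<subseteq> exponents R"
  unfolding cell_def using exponents_mono[of "R - \<sigma>" R] by auto

text \<open>All vectors on \<open>R - \<sigma>\<close> are divided into cells, and the resulting identity of Hilbert series is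
  multiplied by \<open>(1 - X) ^ card (R - \<sigma>)\<close>.\<close>

lemma coparking_orthant_identity:
  assumes "\<sigma> \<subseteq> R"
  shows "(\<Sum>\<rho> | \<sigma> \<subseteq> \<rho> \<and> \<rho> \<subseteq> R.
    fps_X ^ card (U \<rho> - A \<sigma>) * (1 - fps_X) ^ card (R - \<rho>) * degree_gf (coparking \<rho> R)) = 1"
proof -
  let ?J = "{\<rho>. \<sigma> \<subseteq> \<rho> \<and> \<rho> \<subseteq> R}"
  have finJ: "finite ?J" using finite_R by (intro finite_subset[of ?J "Pow R"]) auto
  have "exponents (R - \<sigma>) = (\<Union>\<rho>\<in>?J. cell \<sigma> \<rho> (exponents (\<rho> - \<sigma>)))"
  proof
    show "exponents (R - \<sigma>) \<subseteq> (\<Union>\<rho>\<in>?J. cell \<sigma> \<rho> (exponents (\<rho> - \<sigma>)))"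
    proof
      fix a assume "a \<in> exponents (R - \<sigma>)"
      then have "a \<in> cell \<sigma> (max_fired \<sigma> a) (exponents (max_fired \<sigma> a - \<sigma>))"
        unfolding cell_def by (auto simp: exponents_def)
      then show "a \<in> (\<Union>\<rho>\<in>?J. cell \<sigma> \<rho> (exponents (\<rho> - \<sigma>)))"
        using max_fired_fires(1,2)[OF assms, of a] by (intro UN_I[of "max_fired \<sigma> a"]) auto
    qed
  qed (auto simp: cell_def)
  then have "degree_gf (exponents (R - \<sigma>)) = degree_gf (\<Union>\<rho>\<in>?J. cell \<sigma> \<rho> (exponents (\<rho> - \<sigma>)))"
    by simp
  also have "\<dots> = (\<Sum>\<rho>\<in>?J. degree_gf (cell \<sigma> \<rho> (exponents (\<rho> - \<sigma>))))"
    by (rule degree_gf_UN[OF finite_R finJ]) (use cell_subset cell_disjoint in auto)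
  also have "\<dots> = (\<Sum>\<rho>\<in>?J. fps_X ^ card (U \<rho> - A \<sigma>) * degree_gf (exponents (\<rho> - \<sigma>)) *
      degree_gf (coparking \<rho> R))"
    by (rule sum.cong) (auto simp: degree_gf_cell)
  finally have eq: "degree_gf (exponents (R - \<sigma>)) = \<dots>" .
  have "1 = (1 - fps_X) ^ card (R - \<sigma>) * degree_gf (exponents (R - \<sigma>))"
    using degree_gf_exponents[of "R - \<sigma>"] finite_R by simp
  also have "\<dots> = (\<Sum>\<rho>\<in>?J. fps_X ^ card (U \<rho> - A \<sigma>) *
      ((1 - fps_X) ^ card (R - \<sigma>) * degree_gf (exponents (\<rho> - \<sigma>))) * degree_gf (coparking \<rho> R))"
    unfolding eq sum_distrib_left by (simp add: mult_ac)
  also have "\<dots> = (\<Sum>\<rho>\<in>?J. fps_X ^ card (U \<rho> - A \<sigma>) * (1 - fps_X) ^ card (R - \<rho>) *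
      degree_gf (coparking \<rho> R))"
  proof (rule sum.cong)
    fix \<rho> assume \<rho>: "\<rho> \<in> ?J"
    then have fin: "finite (\<rho> - \<sigma>)" "finite (R - \<rho>)" using finite_R finite_subset by auto
    have "R - \<sigma> = (R - \<rho>) \<union> (\<rho> - \<sigma>)" using \<rho> by auto
    then have "card (R - \<sigma>) = card (R - \<rho>) + card (\<rho> - \<sigma>)"
      using fin by (simp only:) (rule card_Un_disjoint, auto)
    then have "(1 - fps_X) ^ card (R - \<sigma>) * degree_gf (exponents (\<rho> - \<sigma>)) =
        (1 - fps_X) ^ card (R - \<rho>) * ((1 - fps_X) ^ card (\<rho> - \<sigma>) * degree_gf (exponents (\<rho> - \<sigma>)))"
      by (simp add: power_add mult.assoc)
    then have "(1 - fps_X) ^ card (R - \<sigma>) * degree_gf (exponents (\<rho> - \<sigma>)) =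
        (1 - fps_X) ^ card (R - \<rho>)"
      by (simp only: degree_gf_exponents[OF fin(1)] mult_1_right)
    then show "fps_X ^ card (U \<rho> - A \<sigma>) *
      ((1 - fps_X) ^ card (R - \<sigma>) * degree_gf (exponents (\<rho> - \<sigma>))) * degree_gf (coparking \<rho> R) =
      fps_X ^ card (U \<rho> - A \<sigma>) * (1 - fps_X) ^ card (R - \<rho>) * degree_gf (coparking \<rho> R)"
      by simp
  qed simp
  finally show ?thesis by simp
qed

text \<open>The burning algorithm. The condition for the full set \<open>T\<close> yields an \<open>i\<close> with \<open>c i < b T i\<close>. Raising \<open>c i\<close>
  to \<open>b T i - 1\<close> is harmless, as every stratum in \<open>T\<close> containing \<open>i\<close> has at least this baseline at \<open>i\<close>;
  strata avoiding \<open>i\<close> are handled in \<open>T - {i}\<close>. The elements of \<open>A T - A \<rho>\<close> are counted by the last circuit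
  in this order that contains them, which gives the degree.\<close>

lemma coparking_below_top_degree:
  assumes "\<rho> \<subseteq> T" "T \<subseteq> R" "c \<in> coparking \<rho> T"
  shows "\<exists>c'\<in>coparking \<rho> T. c \<le> c' \<and> total_degree c' + card (T - \<rho>) = card (A T - A \<rho>)"
proof -
  have "finite T" using assms finite_R finite_subset by blast
  then show ?thesis using assms
  proof (induction "card (T - \<rho>)" arbitrary: T c)
    case 0
    then have T: "T = \<rho>" by auto
    then have "c = (\<lambda>_. 0)" using 0 by (auto simp: coparking_def exponents_def)
    then show ?case using 0(5) T by auto
  next
    case (Suc n)
    then have "\<rho> \<subset> T" by (metis Diff_cancel card.empty nat.distinct(1) psubsetI)
    then obtain i where i: "i \<in> T - \<rho>" "c i < b T i"
      using Suc.prems unfolding coparking_def by blast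
    let ?T = "T - {i}"
    have finT: "finite ?T" and TR: "?T \<subseteq> R" and rT: "\<rho> \<subseteq> ?T" and iR: "i \<in> R"
      using Suc.prems i by auto
    have n: "n = card (?T - \<rho>)"
    proof -
      have "?T - \<rho> = (T - \<rho>) - {i}" by auto
      then show ?thesis using Suc.hyps(2) i Suc.prems(1) by simp
    qed
    have "c(i := 0) \<in> coparking \<rho> ?T"
    proof -
      have "\<exists>j\<in>\<tau> - \<rho>. (c(i := 0)) j < b \<tau> j" if "\<rho> \<subset> \<tau>" "\<tau> \<subseteq> ?T" for \<tau>
      proof -
        have "\<tau> \<subseteq> T" "i \<notin> \<tau>" using that by auto
        then obtain j where "j \<in> \<tau> - \<rho>" "c j < b \<tau> j"
          using Suc.prems(4) \<open>\<rho> \<subset> \<tau>\<close> unfolding coparking_def by blast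
        then show ?thesis using \<open>i \<notin> \<tau>\<close> by (intro bexI[of _ j]) auto
      qed
      moreover have "c(i := 0) \<in> exponents (?T - \<rho>)"
        using Suc.prems(4) unfolding coparking_def exponents_def by auto
      ultimately show ?thesis unfolding coparking_def by blast
    qed
    then obtain c' where c': "c' \<in> coparking \<rho> ?T" "c(i := 0) \<le> c'"
        "total_degree c' + card (?T - \<rho>) = card (A ?T - A \<rho>)"
      using Suc.hyps(1)[OF n finT rT TR] by blast
    let ?c = "c'(i := b T i - 1)"
    have "c' \<in> exponents (?T - \<rho>)" using c' by (simp add: coparking_def)
    then have c0: "c' j = 0" if "j \<notin> ?T - \<rho>" for j using that by (simp add: exponents_def)
    have e: "?c \<in> exponents (T - \<rho>)" using c0 i by (auto simp: exponents_def)
    have cop: "?c \<in> coparking \<rho> T"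
      unfolding coparking_def
    proof (clarify, intro conjI allI impI)
      show "?c \<in> exponents (T - \<rho>)" by (rule e)
      fix \<tau> assume \<tau>: "\<rho> \<subset> \<tau>" "\<tau> \<subseteq> T"
      show "\<exists>j\<in>\<tau> - \<rho>. ?c j < b \<tau> j"
      proof (cases "i \<in> \<tau>")
        case True
        then have "b T i \<le> b \<tau> i" using baseline_antimono \<tau> Suc.prems by blast
        then have "?c i < b \<tau> i" using i by simp
        then show ?thesis using True i by blast
      next
        case False
        then have "\<tau> \<subseteq> ?T" using \<tau> by auto
        then obtain j where "j \<in> \<tau> - \<rho>" "c' j < b \<tau> j"
          using c'(1) \<tau> unfolding coparking_def by blast
        then show ?thesis using False by (intro bexI[of _ j]) auto
      qed
    qed
    have le: "c \<le> ?c"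
    proof (rule le_funI)
      fix j show "c j \<le> ?c j"
        using le_funD[OF c'(2), of j] i by (cases "j = i") auto
    qed
    have "total_degree ?c = sum ?c (insert i (?T - \<rho>))"
    proof -
      have "T - \<rho> = insert i (?T - \<rho>)" using i by auto
      then show ?thesis using total_degree_eq_sum[OF e] Suc.prems(1) by simp
    qed
    also have "\<dots> = (b T i - 1) + sum c' (?T - \<rho>)"
      using finT by (subst sum.insert) (auto intro!: sum.cong)
    also have "sum c' (?T - \<rho>) = total_degree c'"
      using total_degree_eq_sum[of c' "?T - \<rho>"] c'(1) finT by (simp add: coparking_def)
    finally have deg: "total_degree ?c = (b T i - 1) + total_degree c'" .
    have "card (A T - A \<rho>) = card (A ?T - A \<rho>) + card (C i \<inter> U T)"
    proof -
      have "A T - A \<rho> = (A ?T - A \<rho>) \<union> (C i \<inter> U T)"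
      proof (rule set_eqI)
        fix e
        have "\<rho> \<subseteq> R" using rT TR by auto
        note A_eqs = A_eq[OF Suc.prems(3)] A_eq[OF TR] A_eq[OF this]
        show "e \<in> A T - A \<rho> \<longleftrightarrow> e \<in> (A ?T - A \<rho>) \<union> (C i \<inter> U T)"
        proof (cases "e \<in> A ?T")
          case True
          then have "e \<notin> C i \<inter> U T"
            using U_unique[OF Suc.prems(3), of e i] i A_eqs by auto
          then show ?thesis using True A_eqs by auto
        next
          case False
          then have "e \<in> A T \<longleftrightarrow> e \<in> C i" "e \<notin> A \<rho>" using A_eqs i rT by auto
          moreover have "e \<in> U T" if "e \<in> C i"
          proof (rule U_memI[OF Suc.prems(3)])
            show "i \<in> T" using i by simp
            show "j = i" if "j \<in> T" "e \<in> C j" for j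
              using that False A_eqs by auto
          qed (rule that)
          ultimately show ?thesis using False by auto
        qed
      qed
      moreover have "(A ?T - A \<rho>) \<inter> (C i \<inter> U T) = {}"
        unfolding A_eq[OF TR] using U_unique[OF Suc.prems(3), of _ i] i by auto
      moreover have "finite (C i \<inter> U T)" using finite_subset[OF U_subset_A finite_A] by auto
      ultimately show ?thesis using finite_A by (simp add: card_Un_disjoint)
    qed
    moreover have "b T i = card (C i \<inter> U T)" using i by (simp add: baseline_def)
    ultimately have "total_degree ?c + card (T - \<rho>) = card (A T - A \<rho>)"
      using deg c'(3) n Suc.hyps(2) i by linarith
    then show ?case using cop le by blast
  qed
qed

end


section \<open>Random subsets\<close>

lemma one_minus_X_nonzero: "(1 - fps_X :: int fps) ^ n \<noteq> 0"
proof -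
  have "(1 - fps_X :: int fps) $ 0 \<noteq> 0 $ 0" by simp
  then have "(1 - fps_X :: int fps) \<noteq> 0" by metis
  then show ?thesis by simp
qed

text \<open>The expectation of \<open>f\<close> at a random subset of \<open>E\<close> that contains each element independently with
  probability \<open>X\<close>, the indeterminate.\<close>

definition expect :: "'a set \<Rightarrow> ('a set \<Rightarrow> int fps) \<Rightarrow> int fps" where
  "expect E f = (\<Sum>X\<in>Pow E. fps_X ^ card X * (1 - fps_X) ^ card (E - X) * f X)"

lemma expect_cong: "(\<And>X. X \<subseteq> E \<Longrightarrow> f X = g X) \<Longrightarrow> expect E f = expect E g"
  unfolding expect_def by (rule sum.cong) auto

lemma expect_product:
  assumes "finite P" "finite Q" "P \<inter> Q = {}"
  shows "expect (P \<union> Q) (\<lambda>X. f (X \<inter> P) * g (X \<inter> Q)) = expect P f * expect Q g"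
proof -
  let ?w = "\<lambda>E X. fps_X ^ card X * (1 - fps_X) ^ card (E - X) :: int fps"
  have "expect P f * expect Q g =
      (\<Sum>(X, Y)\<in>Pow P \<times> Pow Q. (?w P X * f X) * (?w Q Y * g Y))"
    unfolding expect_def by (simp add: sum_product sum.cartesian_product)
  also have "\<dots> = (\<Sum>X\<in>Pow (P \<union> Q). ?w (P \<union> Q) X * (f (X \<inter> P) * g (X \<inter> Q)))"
  proof (rule sum.reindex_bij_witness[where i = "\<lambda>X. (X \<inter> P, X \<inter> Q)" and j = "\<lambda>(X, Y). X \<union> Y"])
    fix XY assume "XY \<in> Pow P \<times> Pow Q"
    then obtain X Y where XY: "XY = (X, Y)" "X \<subseteq> P" "Y \<subseteq> Q" by auto
    have fin: "finite X" "finite Y" using XY assms by (auto intro: finite_subset)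
    have int: "(X \<union> Y) \<inter> P = X" "(X \<union> Y) \<inter> Q = Y" using XY assms by auto
    have "P \<union> Q - (X \<union> Y) = (P - X) \<union> (Q - Y)" using XY assms by auto
    then have "card (P \<union> Q - (X \<union> Y)) = card (P - X) + card (Q - Y)"
      using assms by (simp only:) (rule card_Un_disjoint, auto)
    moreover have "card (X \<union> Y) = card X + card Y"
      using XY assms fin by (intro card_Un_disjoint) auto
    ultimately show "?w (P \<union> Q) (case XY of (X, Y) \<Rightarrow> X \<union> Y) *
        (f ((case XY of (X, Y) \<Rightarrow> X \<union> Y) \<inter> P) * g ((case XY of (X, Y) \<Rightarrow> X \<union> Y) \<inter> Q)) =
        (case XY of (X, Y) \<Rightarrow> (?w P X * f X) * (?w Q Y * g Y))"
      by (simp add: XY int power_add mult_ac)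
  qed (use assms in auto)
  finally show ?thesis by (simp add: expect_def)
qed

lemma expect_one: "finite E \<Longrightarrow> expect E (\<lambda>_. 1) = 1"
proof (induction E rule: finite_induct)
  case empty
  show ?case by (simp add: expect_def)
next
  case (insert e E)
  have "expect {e} (\<lambda>_. 1) = 1"
    by (simp add: expect_def Pow_insert)
  then show ?case
    using expect_product[of "{e}" E "\<lambda>_. 1" "\<lambda>_. 1"] insert by simp
qed

lemma expect_contains: "finite V \<Longrightarrow> expect V (\<lambda>X. of_bool (V \<subseteq> X)) = fps_X ^ card V"
proof -
  assume "finite V"
  then have "expect V (\<lambda>X. of_bool (V \<subseteq> X)) =
      (\<Sum>X\<in>{V}. fps_X ^ card X * (1 - fps_X) ^ card (V - X) * of_bool (V \<subseteq> X))"
    unfolding expect_def by (intro sum.mono_neutral_right) auto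
  then show ?thesis by simp
qed

lemma expect_marginal:
  assumes "finite E" "P \<subseteq> E" shows "expect E (\<lambda>X. f (X \<inter> P)) = expect P f"
proof -
  have "finite P" "finite (E - P)" "P \<union> (E - P) = E" using assms by (auto intro: finite_subset)
  then show ?thesis
    using expect_product[of P "E - P" f "\<lambda>_. 1"] by (simp add: expect_one)
qed

text \<open>The events concern disjoint parts of \<open>E\<close>, so the probabilities multiply.\<close>

lemma expect_independent:
  assumes "finite E" "P \<subseteq> E" "V \<subseteq> E" "P \<inter> V = {}"
  shows "expect E (\<lambda>X. of_bool (V \<subseteq> X) * f (X \<inter> P)) = fps_X ^ card V * expect E (\<lambda>X. f (X \<inter> P))"
proof -
  have fin: "finite P" "finite V" using assms by (auto intro: finite_subset)
  have "expect E (\<lambda>X. of_bool (V \<subseteq> X) * f (X \<inter> P)) =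
      expect E (\<lambda>X. (\<lambda>Y. f (Y \<inter> P) * of_bool (V \<subseteq> Y \<inter> V)) (X \<inter> (P \<union> V)))"
  proof (rule expect_cong)
    fix X
    have "X \<inter> (P \<union> V) \<inter> P = X \<inter> P" "V \<subseteq> X \<inter> (P \<union> V) \<inter> V \<longleftrightarrow> V \<subseteq> X" by auto
    then show "of_bool (V \<subseteq> X) * f (X \<inter> P) =
        f (X \<inter> (P \<union> V) \<inter> P) * of_bool (V \<subseteq> X \<inter> (P \<union> V) \<inter> V)"
      by (simp add: mult.commute)
  qed
  also have "\<dots> = expect (P \<union> V) (\<lambda>Y. f (Y \<inter> P) * of_bool (V \<subseteq> Y \<inter> V))"
    by (rule expect_marginal) (use assms in auto)
  also have "\<dots> = expect P f * fps_X ^ card V"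
    using expect_product[of P V f "\<lambda>Y. of_bool (V \<subseteq> Y)"] fin assms by (simp add: expect_contains)
  also have "expect P f = expect E (\<lambda>X. f (X \<inter> P))"
    using expect_marginal[of E P f] assms by simp
  finally show ?thesis by (simp add: mult.commute)
qed

lemma expect_sum: "expect E (\<lambda>X. \<Sum>j\<in>J. f j X) = (\<Sum>j\<in>J. expect E (f j))"
  unfolding expect_def sum_distrib_left by (rule sum.swap)

lemma expect_indicator:
  assumes "finite E" "\<I> \<subseteq> Pow E"
  shows "expect E (\<lambda>X. of_bool (X \<in> \<I>)) = (\<Sum>X\<in>\<I>. fps_X ^ card X * (1 - fps_X) ^ (card E - card X))"
  unfolding expect_def
proof (rule sum.mono_neutral_cong_right)
  fix X assume "X \<in> \<I>"
  then have "X \<subseteq> E" using assms by auto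
  then have "card (E - X) = card E - card X"
    using assms(1) finite_subset by (metis card_Diff_subset)
  then show "fps_X ^ card X * (1 - fps_X) ^ card (E - X) * of_bool (X \<in> \<I>) =
      fps_X ^ card X * (1 - fps_X :: int fps) ^ (card E - card X)"
    using \<open>X \<in> \<I>\<close> by simp
qed (use assms in auto)

section \<open>The decomposition of the \<open>h\<close>-vector\<close>

context based_matroid
begin

text \<open>The Moebius coefficient at \<open>\<sigma>\<close> of the set function \<open>\<tau> \<mapsto> [X \<inter> A \<tau> independent]\<close>. The
  sign \<open>(-1) ^ (card \<sigma> - card \<tau>)\<close> is split into two factors to avoid truncated subtraction.\<close>

definition defect :: "'a set \<Rightarrow> 'a set \<Rightarrow> int fps" where
  "defect X \<sigma> = (-1) ^ card \<sigma> * (\<Sum>\<tau>\<in>Pow \<sigma>. (-1) ^ card \<tau> * of_bool (X \<inter> A \<tau> \<in> indeps M))"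

lemma defect_local: "\<sigma> \<subseteq> R \<Longrightarrow> defect (X \<inter> A \<sigma>) \<sigma> = defect X \<sigma>"
proof -
  assume s: "\<sigma> \<subseteq> R"
  have "X \<inter> A \<sigma> \<inter> A \<tau> = X \<inter> A \<tau>" if "\<tau> \<subseteq> \<sigma>" for \<tau>
    using A_mono[OF that s] by auto
  then show ?thesis unfolding defect_def by (intro arg_cong2[of _ _ _ _ "(*)"] sum.cong) auto
qed

lemma sum_defect:
  assumes "finite \<rho>"
  shows "(\<Sum>\<sigma>\<in>Pow \<rho>. defect X \<sigma>) = of_bool (X \<inter> A \<rho> \<in> indeps M)"
  unfolding defect_def
  by (rule inclusion_exclusion_symmetric[symmetric, OF _ assms]) simp

text \<open>Adding \<open>i\<close> to \<open>\<tau>\<close> does not change whether \<open>X \<inter> A \<tau>\<close> is independent but flips the sign, so the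
  terms cancel in pairs.\<close>

lemma defect_eq_0:
  assumes "\<sigma> \<subseteq> R" "i \<in> \<sigma>" "e \<in> C i" "e \<notin> A (\<sigma> - {i})" "e \<notin> X"
  shows "defect X \<sigma> = 0"
proof -
  let ?f = "\<lambda>\<tau>. (-1) ^ card \<tau> * of_bool (X \<inter> A \<tau> \<in> indeps M) :: int fps"
  let ?P = "Pow (\<sigma> - {i})"
  have fin: "finite \<sigma>" using assms finite_R finite_subset by blast
  have "Pow \<sigma> = ?P \<union> insert i ` ?P"
    using Pow_insert[of i "\<sigma> - {i}"] assms by (simp add: insert_absorb)
  then have "sum ?f (Pow \<sigma>) = sum ?f ?P + sum ?f (insert i ` ?P)"
    using fin by (simp only:) (rule sum.union_disjoint, auto)
  also have "sum ?f (insert i ` ?P) = (\<Sum>\<tau>\<in>?P. ?f (insert i \<tau>))"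
    by (rule sum.reindex_cong[of "insert i"]) (auto simp: inj_on_def)
  also have "\<dots> = (\<Sum>\<tau>\<in>?P. - ?f \<tau>)"
  proof (rule sum.cong)
    fix \<tau> assume \<tau>: "\<tau> \<in> ?P"
    have "X \<inter> A (insert i \<tau>) \<in> indeps M \<longleftrightarrow> X \<inter> A \<tau> \<in> indeps M"
    proof (rule indep_insert_private)
      have "A \<tau> \<subseteq> A (\<sigma> - {i})" by (rule A_mono) (use \<tau> assms in auto)
      then show "e \<notin> A \<tau>" using assms by auto
    qed (use assms \<tau> in auto)
    moreover have "card (insert i \<tau>) = Suc (card \<tau>)"
      using \<tau> fin finite_subset[of \<tau> \<sigma>] by (intro card_insert_disjoint) auto
    ultimately show "?f (insert i \<tau>) = - ?f \<tau>" by simp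
  qed simp
  finally show ?thesis by (simp add: defect_def sum_negf)
qed

text \<open>If \<open>U \<rho> \<subseteq> X\<close>, this is Moebius inversion. Otherwise every term vanishes: take \<open>e \<in> U \<rho> - X\<close> and its
  circuit \<open>C i\<close>. If \<open>i \<in> \<sigma>\<close>, the coefficient is zero because \<open>e\<close> is private to \<open>C i\<close>; if \<open>i \<notin> \<sigma>\<close>,
  then \<open>e \<in> U \<rho> - A \<sigma>\<close> and the first factor is zero.\<close>

lemma sum_defect_restricted:
  assumes "\<rho> \<subseteq> R"
  shows "(\<Sum>\<sigma>\<in>Pow \<rho>. of_bool (U \<rho> - A \<sigma> \<subseteq> X) * defect X \<sigma>) =
    of_bool (U \<rho> \<subseteq> X) * of_bool (X \<inter> A \<rho> \<in> indeps M)"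
proof (cases "U \<rho> \<subseteq> X")
  case True
  then have "U \<rho> - A \<sigma> \<subseteq> X" for \<sigma> by auto
  moreover have "finite \<rho>" using assms finite_R finite_subset by blast
  ultimately show ?thesis using True sum_defect by simp
next
  case False
  then obtain e where e: "e \<in> U \<rho>" "e \<notin> X" by auto
  then obtain i where i: "i \<in> \<rho>" "e \<in> C i" using U_memE[OF assms] by auto
  have "of_bool (U \<rho> - A \<sigma> \<subseteq> X) * defect X \<sigma> = 0" if "\<sigma> \<in> Pow \<rho>" for \<sigma>
  proof (cases "i \<in> \<sigma>")
    case True
    have sub: "\<sigma> \<subseteq> R" "\<sigma> - {i} \<subseteq> R" using that assms by auto
    have "e \<notin> A (\<sigma> - {i})"
      unfolding A_eq[OF sub(2)] using U_unique[OF assms e(1) i] that by auto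
    then show ?thesis using defect_eq_0[OF sub(1) True i(2) _ e(2)] by simp
  next
    case False
    have sub: "\<sigma> \<subseteq> R" using that assms by auto
    have "e \<notin> A \<sigma>"
      unfolding A_eq[OF sub] using U_unique[OF assms e(1) i] that False by auto
    then have "\<not> U \<rho> - A \<sigma> \<subseteq> X" using e by auto
    then show ?thesis by simp
  qed
  then have "(\<Sum>\<sigma>\<in>Pow \<rho>. of_bool (U \<rho> - A \<sigma> \<subseteq> X) * defect X \<sigma>) = 0"
    by (rule sum.neutral[OF ballI])
  then show ?thesis using False by simp
qed

lemma expect_indep_containing_U:
  assumes "\<rho> \<subseteq> R"
  shows "expect (ground M) (\<lambda>X. of_bool (U \<rho> \<subseteq> X) * of_bool (X \<inter> A \<rho> \<in> indeps M)) =
    (\<Sum>\<sigma>\<in>Pow \<rho>. fps_X ^ card (U \<rho> - A \<sigma>) * expect (ground M) (\<lambda>X. defect X \<sigma>))"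
proof -
  have "expect (ground M) (\<lambda>X. of_bool (U \<rho> - A \<sigma> \<subseteq> X) * defect X \<sigma>) =
      fps_X ^ card (U \<rho> - A \<sigma>) * expect (ground M) (\<lambda>X. defect X \<sigma>)" if "\<sigma> \<in> Pow \<rho>" for \<sigma>
  proof -
    have "\<sigma> \<subseteq> R" using that assms by auto
    from expect_independent[OF finite_ground, of "A \<sigma>" "U \<rho> - A \<sigma>" "\<lambda>X. defect X \<sigma>"]
    show ?thesis using A_ground U_subset_A[of \<rho>] by (force simp: defect_local[OF \<open>\<sigma> \<subseteq> R\<close>])
  qed
  then show ?thesis
    by (simp add: sum_defect_restricted[OF assms, symmetric] expect_sum)
qed

lemma expect_indep:
  "expect (ground M) (\<lambda>X. of_bool (X \<in> indeps M)) = (\<Sum>\<sigma>\<in>Pow R. expect (ground M) (\<lambda>X. defect X \<sigma>))"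
  by (simp add: sum_defect[OF finite_R] indep_iff_indep_A flip: expect_sum cong: expect_cong)

text \<open>An independent set \<open>I\<close> has probability \<open>X ^ card I * (1 - X) ^ (card (ground M) - card I)\<close>, and
  \<open>card (ground M)\<close> exceeds the rank by \<open>card R\<close>.\<close>

lemma h_gf_M: "(1 - fps_X) ^ card R * h_gf M = expect (ground M) (\<lambda>X. of_bool (X \<in> indeps M))"
proof -
  have sub: "indeps M \<subseteq> Pow (ground M)" using indeps_subset by auto
  have "(1 - fps_X) ^ card R * (fps_X ^ card I * (1 - fps_X) ^ (card B0 - card I)) =
      fps_X ^ card I * (1 - fps_X :: int fps) ^ (card (ground M) - card I)" if "I \<in> indeps M" for I
  proof -
    have "card I \<le> card B0"
      using card_le_rank_M[OF that, of "ground M"] rank_ground that indeps_subset by simp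
    then have "card (ground M) - card I = card R + (card B0 - card I)" using card_ground by simp
    then show ?thesis by (simp only: power_add mult_ac)
  qed
  then show ?thesis
    unfolding h_gf_eq[OF finite_ground sub empty_indep] expect_indicator[OF finite_ground sub]
      rank_ground sum_distrib_left
    by (rule sum.cong[OF refl])
qed

lemma rank_restriction: "rank (restriction M Y) X = rank M (X \<inter> Y)"
  by (simp add: rank_def restriction_def) (metis (no_types, lifting))

lemma
  assumes "U \<rho> \<in> indeps M"
  shows ground_dead_node: "ground (dead_node M B0 \<rho>) = A \<rho> - U \<rho>"
    and indeps_dead_node: "indeps (dead_node M B0 \<rho>) = {I. I \<subseteq> A \<rho> - U \<rho> \<and> I \<union> U \<rho> \<in> indeps M}"
    and rank_dead_node: "rank (dead_node M B0 \<rho>) (A \<rho> - U \<rho>) + card (U \<rho>) = rank M (A \<rho>)"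
proof -
  have AE: "ground M \<inter> A \<rho> = A \<rho>" using A_ground by auto
  have rU: "rank M (U \<rho>) = card (U \<rho>)"
    using rank_eq_card_iff_M assms finite_indep by blast
  show "ground (dead_node M B0 \<rho>) = A \<rho> - U \<rho>"
    by (simp add: dead_node_def contraction_def restriction_def AE)
  show ind: "indeps (dead_node M B0 \<rho>) = {I. I \<subseteq> A \<rho> - U \<rho> \<and> I \<union> U \<rho> \<in> indeps M}"
  proof -
    have "rank M ((I \<union> U \<rho>) \<inter> A \<rho>) = card I + rank M (U \<rho> \<inter> A \<rho>) \<longleftrightarrow> I \<union> U \<rho> \<in> indeps M"
      if I: "I \<subseteq> A \<rho> - U \<rho>" for I
    proof -
      have "(I \<union> U \<rho>) \<inter> A \<rho> = I \<union> U \<rho>" "U \<rho> \<inter> A \<rho> = U \<rho>" using I U_subset_A[of \<rho>] by auto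
      moreover have fin: "finite I" "finite (U \<rho>)"
        using I finite_A[of \<rho>] finite_subset U_subset_A[of \<rho>] by blast+
      moreover from fin have "card (I \<union> U \<rho>) = card I + card (U \<rho>)"
        using I by (intro card_Un_disjoint) auto
      ultimately show ?thesis using rank_eq_card_iff_M[of "I \<union> U \<rho>"] rU by simp
    qed
    then show ?thesis
      by (auto simp: dead_node_def contraction_def rank_restriction) (auto simp: restriction_def AE)
  qed
  let ?K = "dead_node M B0 \<rho>"
  have finK: "finite (indeps ?K)"
    unfolding ind by (rule finite_subset[of _ "Pow (A \<rho>)"]) (use finite_A[of \<rho>] in auto)
  have empK: "{} \<in> indeps ?K" unfolding ind using assms by simp
  obtain I where I: "I \<in> indeps ?K" "card I = rank ?K (A \<rho> - U \<rho>)"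
    using rank_attained[OF finK empK] .
  then have "I \<union> U \<rho> \<in> indeps M" "I \<inter> U \<rho> = {}" "I \<union> U \<rho> \<subseteq> A \<rho>"
    using U_subset_A[of \<rho>] unfolding ind by auto
  moreover from this have "card (I \<union> U \<rho>) = card I + card (U \<rho>)"
    using finite_indep[of "I \<union> U \<rho>"] by (intro card_Un_disjoint) auto
  ultimately have le: "rank ?K (A \<rho> - U \<rho>) + card (U \<rho>) \<le> rank M (A \<rho>)"
    using card_le_rank_M[of "I \<union> U \<rho>" "A \<rho>"] I by simp
  obtain J where J: "J \<in> indeps M" "U \<rho> \<subseteq> J" "J \<subseteq> A \<rho>" "card J = rank M (A \<rho>)"
    using extend_indep[OF assms U_subset_A] .
  then have "J - U \<rho> \<in> indeps ?K" unfolding ind by (auto simp: Un_absorb2)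
  then have "card (J - U \<rho>) \<le> rank ?K (A \<rho> - U \<rho>)"
    using J by (intro card_le_rank[OF finK]) auto
  moreover have "card (J - U \<rho>) = card J - card (U \<rho>)"
    using J assms finite_indep by (intro card_Diff_subset) auto
  ultimately show "rank ?K (A \<rho> - U \<rho>) + card (U \<rho>) = rank M (A \<rho>)" using J le by simp
qed

text \<open>Adding \<open>U \<rho>\<close> to the independent sets of the minor gives the independent subsets of \<open>A \<rho>\<close>
  containing \<open>U \<rho>\<close>. The exponent of \<open>1 - X\<close> grows by the corank \<open>card \<rho>\<close> of \<open>A \<rho>\<close>.\<close>

lemma h_gf_dead_node:
  assumes "\<rho> \<subseteq> R" "U \<rho> \<in> indeps M"
  shows "fps_X ^ card (U \<rho>) * (1 - fps_X) ^ card \<rho> * h_gf (dead_node M B0 \<rho>) =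
    expect (ground M) (\<lambda>X. of_bool (U \<rho> \<subseteq> X) * of_bool (X \<inter> A \<rho> \<in> indeps M))"
proof -
  let ?K = "dead_node M B0 \<rho>"
  let ?Z = "{X. X \<subseteq> A \<rho> \<and> U \<rho> \<subseteq> X \<and> X \<in> indeps M}"
  note K = ground_dead_node[OF assms(2)] indeps_dead_node[OF assms(2)] rank_dead_node[OF assms(2)]
  have hK: "h_gf ?K = (\<Sum>I\<in>indeps ?K. fps_X ^ card I * (1 - fps_X) ^ (rank ?K (A \<rho> - U \<rho>) - card I))"
    using h_gf_eq[of ?K] K(1,2) finite_A[of \<rho>] assms(2) by auto
  have "expect (ground M) (\<lambda>X. of_bool (U \<rho> \<subseteq> X) * of_bool (X \<inter> A \<rho> \<in> indeps M)) =
      expect (ground M) (\<lambda>X. of_bool (X \<inter> A \<rho> \<in> ?Z))"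
    using U_subset_A[of \<rho>] by (intro expect_cong) auto
  also have "\<dots> = expect (A \<rho>) (\<lambda>X. of_bool (X \<in> ?Z))"
    by (rule expect_marginal[OF finite_ground A_ground])
  also have "\<dots> = (\<Sum>X\<in>?Z. fps_X ^ card X * (1 - fps_X) ^ (card (A \<rho>) - card X))"
    by (rule expect_indicator[OF finite_A]) auto
  also have "\<dots> = (\<Sum>I\<in>indeps ?K. fps_X ^ card (U \<rho>) * (1 - fps_X) ^ card \<rho> *
      (fps_X ^ card I * (1 - fps_X) ^ (rank ?K (A \<rho> - U \<rho>) - card I)))"
  proof (rule sum.reindex_bij_witness[where i = "\<lambda>I. I \<union> U \<rho>" and j = "\<lambda>X. X - U \<rho>"])
    fix X assume X: "X \<in> ?Z"
    have fin: "finite X" using X finite_indep by auto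
    have cX: "card X = card (X - U \<rho>) + card (U \<rho>)"
      using X fin by (metis (no_types, lifting) card_Diff_subset card_mono finite_subset
          le_add_diff_inverse2 mem_Collect_eq)
    moreover have "card X \<le> rank M (A \<rho>)" using X by (intro card_le_rank_M) auto
    ultimately have "card (A \<rho>) - card X = card \<rho> + (rank ?K (A \<rho> - U \<rho>) - card (X - U \<rho>))"
      using rank_A[OF assms(1)] K(3) by linarith
    then show "fps_X ^ card (U \<rho>) * (1 - fps_X) ^ card \<rho> *
      (fps_X ^ card (X - U \<rho>) * (1 - fps_X) ^ (rank ?K (A \<rho> - U \<rho>) - card (X - U \<rho>))) =
      fps_X ^ card X * (1 - fps_X :: int fps) ^ (card (A \<rho>) - card X)"
      by (simp add: cX power_add mult_ac)
  qed (use U_subset_A[of \<rho>] in \<open>auto simp: K(2) Un_absorb2\<close>)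
  also have "\<dots> = fps_X ^ card (U \<rho>) * (1 - fps_X) ^ card \<rho> * h_gf ?K"
    unfolding hK sum_distrib_left ..
  finally show ?thesis by simp
qed

text \<open>The summands belong to the dead strata and to \<open>\<rho> = {}\<close>; the latter contributes the coparking
  functions from which nothing can be fired.\<close>

theorem h_gf_decomposition:
  "h_gf M = (\<Sum>\<rho> | \<rho> \<subseteq> R \<and> U \<rho> \<in> indeps M.
    fps_X ^ card (U \<rho>) * h_gf (dead_node M B0 \<rho>) * degree_gf (coparking \<rho> R))"
proof -
  let ?W = "\<lambda>\<sigma>. expect (ground M) (\<lambda>X. defect X \<sigma>)"
  let ?G = "\<lambda>\<rho>. expect (ground M) (\<lambda>X. of_bool (U \<rho> \<subseteq> X) * of_bool (X \<inter> A \<rho> \<in> indeps M))"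
  let ?P = "\<lambda>\<rho>. degree_gf (coparking \<rho> R)"
  let ?q = "1 - fps_X :: int fps"
  have finP: "finite (Pow R)" using finite_R by simp
  have "?q ^ card R * h_gf M = (\<Sum>\<sigma>\<in>Pow R. ?W \<sigma>)"
    by (simp add: h_gf_M expect_indep)
  \<comment> \<open>Each summand is multiplied by the orthant identity for \<open>\<sigma>\<close>.\<close>
  also have "\<dots> = (\<Sum>\<sigma>\<in>Pow R. \<Sum>\<rho> | \<rho> \<in> Pow R \<and> \<sigma> \<subseteq> \<rho>.
      ?W \<sigma> * (fps_X ^ card (U \<rho> - A \<sigma>) * ?q ^ card (R - \<rho>) * ?P \<rho>))"
  proof (rule sum.cong)
    fix \<sigma> assume "\<sigma> \<in> Pow R"
    then have \<sigma>: "\<sigma> \<subseteq> R" by simp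
    have "{\<rho>. \<rho> \<in> Pow R \<and> \<sigma> \<subseteq> \<rho>} = {\<rho>. \<sigma> \<subseteq> \<rho> \<and> \<rho> \<subseteq> R}" by auto
    then show "?W \<sigma> = (\<Sum>\<rho> | \<rho> \<in> Pow R \<and> \<sigma> \<subseteq> \<rho>.
      ?W \<sigma> * (fps_X ^ card (U \<rho> - A \<sigma>) * ?q ^ card (R - \<rho>) * ?P \<rho>))"
      by (simp only: sum_distrib_left[symmetric] coparking_orthant_identity[OF \<sigma>] mult_1_right)
  qed simp
  also have "\<dots> = (\<Sum>\<rho>\<in>Pow R. \<Sum>\<sigma> | \<sigma> \<in> Pow R \<and> \<sigma> \<subseteq> \<rho>.
      ?W \<sigma> * (fps_X ^ card (U \<rho> - A \<sigma>) * ?q ^ card (R - \<rho>) * ?P \<rho>))"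
    by (rule sum.swap_restrict[OF finP finP])
  also have "\<dots> = (\<Sum>\<rho>\<in>Pow R. ?G \<rho> * (?q ^ card (R - \<rho>) * ?P \<rho>))"
  proof (rule sum.cong)
    fix \<rho> assume "\<rho> \<in> Pow R"
    then have \<rho>: "\<rho> \<subseteq> R" by simp
    have "{\<sigma>. \<sigma> \<in> Pow R \<and> \<sigma> \<subseteq> \<rho>} = Pow \<rho>" using \<rho> by auto
    then show "(\<Sum>\<sigma> | \<sigma> \<in> Pow R \<and> \<sigma> \<subseteq> \<rho>.
      ?W \<sigma> * (fps_X ^ card (U \<rho> - A \<sigma>) * ?q ^ card (R - \<rho>) * ?P \<rho>)) =
      ?G \<rho> * (?q ^ card (R - \<rho>) * ?P \<rho>)"
      unfolding expect_indep_containing_U[OF \<rho>] sum_distrib_right by (simp only: mult_ac)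
  qed simp
  also have "\<dots> = (\<Sum>\<rho> | \<rho> \<subseteq> R \<and> U \<rho> \<in> indeps M. ?q ^ card R *
      (fps_X ^ card (U \<rho>) * h_gf (dead_node M B0 \<rho>) * ?P \<rho>))"
  proof (rule sum.mono_neutral_cong_right[OF finP])
    show "\<forall>\<rho>\<in>Pow R - {\<rho>. \<rho> \<subseteq> R \<and> U \<rho> \<in> indeps M}. ?G \<rho> * (?q ^ card (R - \<rho>) * ?P \<rho>) = 0"
    proof
      fix \<rho> assume "\<rho> \<in> Pow R - {\<rho>. \<rho> \<subseteq> R \<and> U \<rho> \<in> indeps M}"
      then have "U \<rho> \<notin> indeps M" by auto
      then have "of_bool (U \<rho> \<subseteq> X) * of_bool (X \<inter> A \<rho> \<in> indeps M) = (0 :: int fps)" for X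
        using indeps_down[of "X \<inter> A \<rho>" "U \<rho>"] U_subset_A[of \<rho>] by auto
      then have "?G \<rho> = 0" by (simp only: expect_def mult_zero_right sum.neutral_const)
      then show "?G \<rho> * (?q ^ card (R - \<rho>) * ?P \<rho>) = 0" by simp
    qed
    fix \<rho> assume \<rho>: "\<rho> \<in> {\<rho>. \<rho> \<subseteq> R \<and> U \<rho> \<in> indeps M}"
    then have "card R = card \<rho> + card (R - \<rho>)"
      using finite_R by (metis (no_types, lifting) card_Diff_subset card_mono finite_subset
          le_add_diff_inverse mem_Collect_eq)
    then show "?G \<rho> * (?q ^ card (R - \<rho>) * ?P \<rho>) =
        ?q ^ card R * (fps_X ^ card (U \<rho>) * h_gf (dead_node M B0 \<rho>) * ?P \<rho>)"
      using \<rho> h_gf_dead_node[of \<rho>] by (simp add: power_add mult_ac flip: h_gf_dead_node)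
  qed auto
  also have "\<dots> = ?q ^ card R * (\<Sum>\<rho> | \<rho> \<subseteq> R \<and> U \<rho> \<in> indeps M.
      fps_X ^ card (U \<rho>) * h_gf (dead_node M B0 \<rho>) * ?P \<rho>)"
    by (simp only: sum_distrib_left)
  finally show ?thesis
    using one_minus_X_nonzero[of "card R"] by (simp only: mult_cancel_left) auto
qed

end


section \<open>The last entry of the \<open>h\<close>-vector\<close>

context matroid
begin

text \<open>Up to the sign of the rank, the reduced Euler characteristic of the independence complex of
  \<open>(M|Y)/V\<close>. For independent \<open>V \<subseteq> Y\<close> it is the last entry of the \<open>h\<close>-vector of this minor: the
  exponent differs from \<open>rank M Y - card V - card I\<close> by an even number.\<close>

definition signed_count :: "'a set \<Rightarrow> 'a set \<Rightarrow> int" where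
  "signed_count Y V = (\<Sum>I | I \<subseteq> Y - V \<and> I \<union> V \<in> indeps M. (-1) ^ (rank M Y + card V + card I))"

text \<open>Deletion and contraction of \<open>e\<close>. In the deletion term the sign still refers to the rank of \<open>Y\<close>, so
  that the identity also holds when \<open>e\<close> is a coloop.\<close>

lemma signed_count_split:
  assumes "finite Y" "V \<subseteq> Y" "e \<in> Y - V"
  shows "signed_count Y V =
    (\<Sum>I | I \<subseteq> Y - {e} - V \<and> I \<union> V \<in> indeps M. (-1) ^ (rank M Y + card V + card I)) +
    signed_count Y (insert e V)"
proof -
  let ?J0 = "{I. I \<subseteq> Y - {e} - V \<and> I \<union> V \<in> indeps M}"
  let ?J1 = "{I. I \<subseteq> Y - insert e V \<and> I \<union> insert e V \<in> indeps M}"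
  let ?s = "\<lambda>I. (-1) ^ (rank M Y + card V + card I) :: int"
  have fin: "finite ?J0" "finite ?J1"
    using assms by (auto intro: finite_subset[of _ "Pow Y"])
  have finV: "finite V" using assms finite_subset by blast
  have "{I. I \<subseteq> Y - V \<and> I \<union> V \<in> indeps M} = ?J0 \<union> insert e ` ?J1"
  proof (intro equalityI subsetI)
    fix I assume I: "I \<in> {I. I \<subseteq> Y - V \<and> I \<union> V \<in> indeps M}"
    show "I \<in> ?J0 \<union> insert e ` ?J1"
    proof (cases "e \<in> I")
      case True
      have "I - {e} \<union> insert e V = I \<union> V" using True by auto
      then have "I - {e} \<in> ?J1" using I by auto
      moreover have "I = insert e (I - {e})" using True by auto
      ultimately show ?thesis by blast
    qed (use I in auto)
  qed (use assms in auto)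
  then have "signed_count Y V = sum ?s ?J0 + sum ?s (insert e ` ?J1)"
    unfolding signed_count_def using fin
    by (simp only:) (rule sum.union_disjoint, auto)
  also have "sum ?s (insert e ` ?J1) = (\<Sum>I\<in>?J1. ?s (insert e I))"
    by (rule sum.reindex_cong[of "insert e"]) (auto simp: inj_on_def)
  also have "\<dots> = signed_count Y (insert e V)"
    unfolding signed_count_def
  proof (rule sum.cong)
    fix I assume I: "I \<in> ?J1"
    then have "finite I" "e \<notin> I" using assms finite_subset by auto
    then show "?s (insert e I) = (-1) ^ (rank M Y + card (insert e V) + card I)"
      using assms finV by simp
  qed simp
  finally show ?thesis .
qed

text \<open>Induction on \<open>Y - V\<close>. Adding and removing a coloop pairs off the terms, so a minor with a coloop
  has signed count zero. If there is none, a non-loop \<open>e\<close> can be deleted and contracted: the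
  deletion contributes a nonnegative and the contraction, which creates no coloops, a positive number.
  If \<open>e\<close> is a loop of the minor, it can simply be deleted.\<close>

lemma signed_count_pos:
  assumes "V \<in> indeps M" "V \<subseteq> Y" "finite Y"
  shows "0 \<le> signed_count Y V \<and>
    ((\<forall>e\<in>Y - V. rank M (Y - {e}) = rank M Y) \<longrightarrow> 0 < signed_count Y V)"
  using assms
proof (induction "card (Y - V)" arbitrary: Y V rule: less_induct)
  case less
  have finV: "finite V" using less.prems finite_subset by blast
  show ?case
  proof (cases "\<exists>e\<in>Y - V. rank M (Y - {e}) \<noteq> rank M Y")
    case True
    then obtain e where e: "e \<in> Y - V" "rank M (Y - {e}) \<noteq> rank M Y" by auto
    have "{I. I \<subseteq> Y - {e} - V \<and> I \<union> V \<in> indeps M} =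
        {I. I \<subseteq> Y - insert e V \<and> I \<union> insert e V \<in> indeps M}"
    proof -
      have "I \<union> V \<in> indeps M \<longleftrightarrow> I \<union> insert e V \<in> indeps M" if I: "I \<subseteq> Y - {e} - V" for I
      proof
        assume ind: "I \<union> V \<in> indeps M"
        have sub: "I \<union> V \<subseteq> Y - {e}" using I e less.prems by auto
        have "insert e (Y - {e}) = Y" using e by auto
        then have "rank M (insert e (I \<union> V)) \<noteq> rank M (I \<union> V)"
          using spanned_mono[OF _ sub, of e] e by auto
        moreover have "rank M (I \<union> V) = card (I \<union> V)"
          using rank_eq_card_iff_M ind finite_indep by blast
        moreover have "card (insert e (I \<union> V)) = Suc (card (I \<union> V))"
          using sub finite_indep[OF ind] by (intro card_insert_disjoint) auto
        ultimately have "rank M (insert e (I \<union> V)) = card (insert e (I \<union> V))"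
          using rank_insert_le[of e "I \<union> V"] rank_insert_ge[of "I \<union> V" e] by linarith
        then show "I \<union> insert e V \<in> indeps M"
          using rank_eq_card_iff_M[of "insert e (I \<union> V)"] finite_indep[OF ind] by simp
      qed (auto intro: indeps_down)
      moreover have "Y - {e} - V = Y - insert e V" by auto
      ultimately show ?thesis by auto
    qed
    then have "signed_count Y V = 0"
      unfolding signed_count_split[OF less.prems(3,2) e(1)]
      using e finV by (simp add: signed_count_def sum_negf)
    then show ?thesis using e by auto
  next
    case coloopfree: False
    have "0 < signed_count Y V"
    proof (cases "Y = V")
      case True
      have "{I. I \<subseteq> Y - V \<and> I \<union> V \<in> indeps M} = {{}}" using True less.prems by auto
      moreover have "rank M Y = card V" using True rank_eq_card_iff_M less.prems by blast
      ultimately show ?thesis by (simp add: signed_count_def)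
    next
      case False
      then obtain e where e: "e \<in> Y - V" using less.prems by auto
      have rankY: "rank M (Y - {e}) = rank M Y" using coloopfree e by auto
      have "card (Y - {e} - V) < card (Y - V)"
        using e less.prems by (intro psubset_card_mono) auto
      note IH1 = less.hyps[OF this less.prems(1)]
      have del: "(\<Sum>I | I \<subseteq> Y - {e} - V \<and> I \<union> V \<in> indeps M. (-1) ^ (rank M Y + card V + card I)) =
          signed_count (Y - {e}) V"
        by (simp add: signed_count_def rankY)
      show ?thesis
      proof (cases "insert e V \<in> indeps M")
        case True
        have "card (Y - insert e V) < card (Y - V)"
          using e less.prems by (intro psubset_card_mono) auto
        from less.hyps[OF this True] have "0 < signed_count Y (insert e V)"
          using e less.prems coloopfree by auto
        moreover have "0 \<le> signed_count (Y - {e}) V" using IH1 e less.prems by auto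
        ultimately show ?thesis
          unfolding signed_count_split[OF less.prems(3,2) e] del by simp
      next
        case False
        have "I \<union> insert e V \<notin> indeps M" for I
          using False indeps_down[of "I \<union> insert e V" "insert e V"] by auto
        then have "signed_count Y (insert e V) = 0" by (simp add: signed_count_def)
        moreover have "rank M (Y - {e} - {f}) = rank M (Y - {e})" if f: "f \<in> Y - {e} - V" for f
        proof -
          have "rank M (insert e V) \<noteq> card (insert e V)"
            using False rank_eq_card_iff_M[of "insert e V"] finV by simp
          moreover have "rank M V = card V" using rank_eq_card_iff_M finV less.prems by blast
          ultimately have "rank M (insert e V) = rank M V"
            using rank_insert_le[of e V] rank_insert_ge[of V e] e finV by simp
          then have "rank M (insert e (Y - {e} - {f})) = rank M (Y - {e} - {f})"
            by (rule spanned_mono) (use f e less.prems in auto)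
          moreover have "insert e (Y - {e} - {f}) = Y - {f}" using e f by auto
          ultimately show ?thesis using coloopfree f rankY by auto
        qed
        then have "0 < signed_count (Y - {e}) V" using IH1 e less.prems by auto
        ultimately show ?thesis
          unfolding signed_count_split[OF less.prems(3,2) e] del by simp
      qed
    qed
    then show ?thesis by simp
  qed
qed

end

context based_matroid
begin

lemma h_vector_dead_node_top:
  assumes "\<rho> \<subseteq> R" "U \<rho> \<in> indeps M"
  shows "0 < h_vector (dead_node M B0 \<rho>) (rank (dead_node M B0 \<rho>) (A \<rho> - U \<rho>))"
proof -
  let ?K = "dead_node M B0 \<rho>"
  let ?d = "rank ?K (A \<rho> - U \<rho>)"
  note K = ground_dead_node[OF assms(2)] indeps_dead_node[OF assms(2)] rank_dead_node[OF assms(2)]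
  have "h_vector ?K ?d = (\<Sum>I\<in>indeps ?K. (-1) ^ (?d - card I))"
    using h_vector_top[of ?K] K(1,2) finite_A[of \<rho>] assms(2) by auto
  also have "\<dots> = signed_count (A \<rho>) (U \<rho>)"
    unfolding signed_count_def K(2)
  proof (rule sum.cong)
    fix I assume I: "I \<in> {I. I \<subseteq> A \<rho> - U \<rho> \<and> I \<union> U \<rho> \<in> indeps M}"
    then have "card (I \<union> U \<rho>) \<le> rank M (A \<rho>)"
      using U_subset_A[of \<rho>] by (intro card_le_rank_M) auto
    moreover have "finite (I \<union> U \<rho>)" using I finite_indep by auto
    then have "card (I \<union> U \<rho>) = card I + card (U \<rho>)"
      using I by (intro card_Un_disjoint) auto
    ultimately have "card I \<le> ?d" using K(3) by simp
    then have "rank M (A \<rho>) + card (U \<rho>) + card I = (?d - card I) + 2 * (card (U \<rho>) + card I)"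
      unfolding K(3)[symmetric] by simp
    then show "(-1) ^ (?d - card I) = (-1 :: int) ^ (rank M (A \<rho>) + card (U \<rho>) + card I)"
      by (simp add: power_add power_mult)
  qed simp
  also have "\<dots> > 0"
    using signed_count_pos[OF assms(2) U_subset_A finite_A] rank_A_remove[OF assms(1)] by auto
  finally show ?thesis .
qed

end


section \<open>Relaxed coparking functions\<close>

context based_matroid
begin

lemma dead_iff: "dead M B0 \<rho> \<longleftrightarrow> \<rho> \<noteq> {} \<and> \<rho> \<subseteq> R \<and> U \<rho> \<in> indeps M"
  by (simp add: dead_def stratum_def)

lemma can_fire_iff: "can_fire M B0 \<tau> a \<longleftrightarrow> \<tau> \<noteq> {} \<and> \<tau> \<subseteq> R \<and> (\<forall>i\<in>\<tau>. b \<tau> i \<le> a i)"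
  by (auto simp: can_fire_def stratum_def)

text \<open>A stratum \<open>\<tau>\<close> that can be fired from \<open>a\<close> lies inside the largest one, \<open>\<rho>\<close>. On \<open>\<rho>\<close> the vector \<open>a\<close>
  equals \<open>b \<rho>\<close> plus an element of the fibre, so the conditions at \<open>\<tau> \<subset> \<rho>\<close> are supplied by the second
  defining property of a fibre.\<close>

lemma relaxed_coparking_iff:
  assumes F: "fibre_system M B0 F" and a: "a \<in> exponents R"
  defines "\<rho> \<equiv> max_fired {} a"
  shows "a \<in> relaxed_coparking M B0 F \<longleftrightarrow> \<rho> = {} \<or> dead M B0 \<rho> \<and> residual M B0 \<rho> a \<in> F \<rho>"
proof
  have \<rho>: "\<rho> \<subseteq> R" "\<And>i. i \<in> \<rho> \<Longrightarrow> b \<rho> i \<le> a i"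
    using max_fired_fires[of "{}", where a = a] by (auto simp: \<rho>_def)
  show "\<rho> = {} \<or> dead M B0 \<rho> \<and> residual M B0 \<rho> a \<in> F \<rho>" if "a \<in> relaxed_coparking M B0 F"
    using that \<rho> by (auto simp: relaxed_coparking_def can_fire_iff)
  assume h: "\<rho> = {} \<or> dead M B0 \<rho> \<and> residual M B0 \<rho> a \<in> F \<rho>"
  have "dead M B0 \<tau> \<and> residual M B0 \<tau> a \<in> F \<tau>" if \<tau>: "can_fire M B0 \<tau> a" for \<tau>
  proof -
    have sub: "\<tau> \<subseteq> \<rho>"
      unfolding \<rho>_def by (rule max_fired_greatest) (use \<tau> in \<open>auto simp: can_fire_iff\<close>)
    then have dead: "dead M B0 \<rho>" and m: "residual M B0 \<rho> a \<in> F \<rho>"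
      using h \<tau> by (auto simp: can_fire_iff)
    show ?thesis
    proof (cases "\<tau> = \<rho>")
      case True
      then show ?thesis using dead m by simp
    next
      case False
      let ?a = "\<lambda>i. b \<rho> i + residual M B0 \<rho> a i"
      have eq: "?a i = a i" if "i \<in> \<rho>" for i using \<rho>(2)[OF that] that by (simp add: residual_def)
      have "can_fire M B0 \<tau> ?a"
        using \<tau> sub eq unfolding can_fire_iff by (metis subsetD)
      moreover have "residual M B0 \<tau> ?a = residual M B0 \<tau> a"
        using sub eq by (auto simp: residual_def fun_eq_iff)
      moreover have "\<tau> \<subset> \<rho>" using sub False by auto
      moreover have "is_fibre M B0 F \<rho> (F \<rho>)" using F dead by (simp add: fibre_system_def)
      then have "\<forall>\<tau>. \<tau> \<subset> \<rho> \<longrightarrow> can_fire M B0 \<tau> ?a \<longrightarrow>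
          dead M B0 \<tau> \<and> residual M B0 \<tau> ?a \<in> F \<tau>"
        using m unfolding is_fibre_def by blast
      ultimately show ?thesis by metis
    qed
  qed
  then show "a \<in> relaxed_coparking M B0 F" using a by (simp add: relaxed_coparking_def)
qed

text \<open>The empty set is not a stratum, but it is the largest fired set of an ordinary coparking function. The
  one-point fibre there is the correct one, since the minor \<open>K\<^sub>\<emptyset>\<close> is empty and has \<open>h\<close>-vector \<open>1\<close>.\<close>

definition fibre :: "('a set \<Rightarrow> ('a \<Rightarrow> nat) set) \<Rightarrow> 'a set \<Rightarrow> ('a \<Rightarrow> nat) set" where
  "fibre F \<rho> = (if \<rho> = {} then {\<lambda>_. 0} else F \<rho>)"

lemma fibre_subset:
  assumes "fibre_system M B0 F" "\<rho> \<subseteq> R" "U \<rho> \<in> indeps M"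
  shows "fibre F \<rho> \<subseteq> exponents \<rho>"
proof (cases "\<rho> = {}")
  case False
  then have "is_fibre M B0 F \<rho> (F \<rho>)" using assms by (auto simp: fibre_system_def dead_iff)
  then show ?thesis using False by (simp add: fibre_def is_fibre_def)
qed (simp add: fibre_def exponents_def)

lemma relaxed_coparking_eq_cells:
  assumes "fibre_system M B0 F"
  shows "relaxed_coparking M B0 F = (\<Union>\<rho>\<in>{\<rho>. \<rho> \<subseteq> R \<and> U \<rho> \<in> indeps M}. cell {} \<rho> (fibre F \<rho>))"
proof -
  have "a \<in> relaxed_coparking M B0 F \<longleftrightarrow>
      (\<exists>\<rho>. \<rho> \<subseteq> R \<and> U \<rho> \<in> indeps M \<and> a \<in> cell {} \<rho> (fibre F \<rho>))" for a
  proof (cases "a \<in> exponents R")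
    case True
    have "(\<lambda>i. if i \<in> {} then x i else 0) = (\<lambda>_. 0 :: nat)" for x :: "'a \<Rightarrow> nat" by auto
    then show ?thesis
      unfolding relaxed_coparking_iff[OF assms True] cell_def
      using True max_fired_fires(2)[of "{}" a] empty_indep
      by (auto simp: dead_iff residual_def fibre_def)
  qed (auto simp: relaxed_coparking_def cell_def)
  then show ?thesis by blast
qed

lemma degree_gf_fibre:
  assumes "fibre_system M B0 F" "\<rho> \<subseteq> R" "U \<rho> \<in> indeps M"
  shows "degree_gf (fibre F \<rho>) = h_gf (dead_node M B0 \<rho>)"
proof (cases "\<rho> = {}")
  case True
  have "h_gf (dead_node M B0 {}) = 1"
    using h_gf_dead_node[of "{}"] empty_indep finite_ground by (simp add: expect_one)
  then show ?thesis using True by (simp add: fibre_def degree_gf_singleton)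
next
  case False
  then have "is_fibre M B0 F \<rho> (F \<rho>)" using assms by (auto simp: fibre_system_def dead_iff)
  then show ?thesis using False by (simp add: fibre_def is_fibre_def degree_gf_def h_gf_def)
qed

lemma degree_sequence_relaxed_coparking:
  assumes "fibre_system M B0 F"
  shows "degree_sequence (relaxed_coparking M B0 F) = h_vector M"
proof -
  let ?J = "{\<rho>. \<rho> \<subseteq> R \<and> U \<rho> \<in> indeps M}"
  have fin: "finite ?J" by (rule finite_subset[of _ "Pow R"]) (use finite_R in auto)
  have "degree_gf (relaxed_coparking M B0 F) = (\<Sum>\<rho>\<in>?J. degree_gf (cell {} \<rho> (fibre F \<rho>)))"
    unfolding relaxed_coparking_eq_cells[OF assms]
    by (rule degree_gf_UN[OF finite_R fin]) (use cell_subset cell_disjoint in auto)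
  also have "\<dots> = (\<Sum>\<rho>\<in>?J. fps_X ^ card (U \<rho>) * h_gf (dead_node M B0 \<rho>) * degree_gf (coparking \<rho> R))"
    by (rule sum.cong) (simp_all add: degree_gf_cell fibre_subset[OF assms] degree_gf_fibre[OF assms])
  also have "\<dots> = h_gf M" by (rule h_gf_decomposition[symmetric])
  finally show ?thesis
    unfolding degree_gf_def h_gf_def by (simp add: fun_eq_iff fps_eq_iff)
qed

text \<open>The last entry of the \<open>h\<close>-vector of the dead node is positive, so some element of the fibre has the
  largest possible degree. It is maximal, and by purity all maximal elements have its degree.\<close>

lemma fibre_below_top_degree:
  assumes F: "fibre_system M B0 F" and \<rho>: "\<rho> \<subseteq> R" "U \<rho> \<in> indeps M" and m: "m \<in> fibre F \<rho>"
  shows "\<exists>m'\<in>fibre F \<rho>. m \<le> m' \<and> total_degree m' + card (U \<rho>) = rank M (A \<rho>)"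
proof (cases "\<rho> = {}")
  case True
  then show ?thesis using m rank_A[of "{}"] by (simp add: fibre_def)
next
  case False
  let ?K = "dead_node M B0 \<rho>" and ?X = "F \<rho>"
  let ?d = "rank ?K (A \<rho> - U \<rho>)"
  have X: "is_fibre M B0 F \<rho> ?X" using F \<rho> False by (auto simp: fibre_system_def dead_iff)
  then have exp: "?X \<subseteq> exponents \<rho>" and pure: "pure_multicomplex ?X"
    and deg: "\<And>k. int (card {a \<in> ?X. total_degree a = k}) = h_vector ?K k"
    by (auto simp: is_fibre_def degree_sequence_def fun_eq_iff)
  have finX: "finite ?X" and fin\<rho>: "finite \<rho>"
    using pure \<rho> finite_R finite_subset by (auto simp: pure_multicomplex_def multicomplex_def)
  have "0 < card {a \<in> ?X. total_degree a = ?d}"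
    using h_vector_dead_node_top[OF \<rho>] deg[of ?d] by simp
  then obtain x where x: "x \<in> ?X" "total_degree x = ?d"
    by (auto simp: card_gt_0_iff)
  have le: "total_degree y \<le> ?d" if "y \<in> ?X" for y
  proof (rule ccontr)
    assume "\<not> total_degree y \<le> ?d"
    then have "h_vector ?K (total_degree y) = 0"
      by (simp add: h_vector_def ground_dead_node[OF \<rho>(2)])
    then have "{a \<in> ?X. total_degree a = total_degree y} = {}"
      using deg[of "total_degree y"] finX by simp
    then show False using that by auto
  qed
  have "maximal_in ?X x"
    unfolding maximal_in_def
  proof (intro conjI ballI impI)
    fix y assume y: "y \<in> ?X" "x \<le> y"
    then have "total_degree x \<le> total_degree y"
      using total_degree_mono[of x \<rho> y] exp x fin\<rho> by auto
    then show "y = x"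
      using eq_if_le_same_degree[of x \<rho> y] exp x y fin\<rho> le[OF y(1)] by auto
  qed (rule x)
  obtain m' where m': "m' \<in> ?X" "m \<le> m'" "\<forall>y\<in>?X. m' \<le> y \<longrightarrow> m' = y"
    using finite_has_maximal2[OF finX, of m] m False by (auto simp: fibre_def)
  then have "maximal_in ?X m'" by (auto simp: maximal_in_def)
  then have "total_degree m' = ?d"
    using pure \<open>maximal_in ?X x\<close> x unfolding pure_multicomplex_def by metis
  then show ?thesis using m' rank_dead_node[OF \<rho>(2)] False by (auto simp: fibre_def)
qed

text \<open>The fibre part and the coparking part of \<open>a\<close> are raised separately, inside the same cell. The
  resulting degree is the same for all cells, which gives purity; it also bounds the degrees of all
  relaxed coparking functions, which gives finiteness.\<close>

lemma relaxed_coparking_below_top_degree: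
  assumes F: "fibre_system M B0 F" and a: "a \<in> relaxed_coparking M B0 F"
  shows "\<exists>a'\<in>relaxed_coparking M B0 F. a \<le> a' \<and> total_degree a' + card R = card (A R)"
proof -
  obtain \<rho> where \<rho>: "\<rho> \<subseteq> R" "U \<rho> \<in> indeps M" and cell: "a \<in> cell {} \<rho> (fibre F \<rho>)"
    using a unfolding relaxed_coparking_eq_cells[OF F] by auto
  have fin: "finite \<rho>" using \<rho> finite_R finite_subset by blast
  let ?\<beta> = "\<lambda>i. if i \<in> \<rho> then b \<rho> i else 0"
  have cells: "cell {} \<rho> (fibre F \<rho>) = sumset {?\<beta>} (sumset (fibre F \<rho>) (coparking \<rho> R))"
    using cell_eq_sumset[of "{}" \<rho> "fibre F \<rho>"] \<rho> fibre_subset[OF F \<rho>] by simp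
  then obtain m c where m: "m \<in> fibre F \<rho>" and c: "c \<in> coparking \<rho> R"
    and a_eq: "a = (\<lambda>i. ?\<beta> i + (m i + c i))"
    using cell unfolding cells sumset_def by auto
  obtain m' where m': "m' \<in> fibre F \<rho>" "m \<le> m'" "total_degree m' + card (U \<rho>) = rank M (A \<rho>)"
    using fibre_below_top_degree[OF F \<rho> m] by auto
  obtain c' where c': "c' \<in> coparking \<rho> R" "c \<le> c'"
      "total_degree c' + card (R - \<rho>) = card (A R - A \<rho>)"
    using coparking_below_top_degree[OF \<rho>(1) _ c] by auto
  let ?a = "\<lambda>i. ?\<beta> i + (m' i + c' i)"
  have "(\<lambda>i. m' i + c' i) \<in> sumset (fibre F \<rho>) (coparking \<rho> R)"
    unfolding sumset_def using m' c' by (intro image_eqI[of _ _ "(m', c')"]) auto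
  then have "?a \<in> cell {} \<rho> (fibre F \<rho>)"
    unfolding cells sumset_def[of "{?\<beta>}"] by (intro image_eqI[of _ _ "(?\<beta>, \<lambda>i. m' i + c' i)"]) auto
  then have "?a \<in> relaxed_coparking M B0 F"
    unfolding relaxed_coparking_eq_cells[OF F] using \<rho> by auto
  moreover have "a \<le> ?a"
    unfolding a_eq using m'(2) c'(2) by (auto simp: le_fun_def intro: add_mono)
  moreover have "total_degree ?a + card R = card (A R)"
  proof -
    have \<beta>: "?\<beta> \<in> exponents \<rho>" by (simp add: exponents_def)
    have "exponents \<rho> \<subseteq> exponents R" "exponents (R - \<rho>) \<subseteq> exponents R"
      using \<rho> by (auto intro!: exponents_mono)
    then have e: "?\<beta> \<in> exponents R" "m' \<in> exponents R" "c' \<in> exponents R"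
      using \<beta> m'(1) c'(1) fibre_subset[OF F \<rho>] by (auto simp: coparking_def)
    have "total_degree ?\<beta> = card (U \<rho>)"
      using sum_baseline[of "{}" \<rho>] \<rho> by (simp add: total_degree_eq_sum[OF \<beta> fin])
    then have "total_degree ?a = card (U \<rho>) + (total_degree m' + total_degree c')"
      using total_degree_plus[OF e(2,3) finite_R]
        total_degree_plus[OF e(1) exponents_plus[OF e(2,3)] finite_R] by simp
    moreover have "card R = card \<rho> + card (R - \<rho>)"
      using card_Diff_subset[OF fin \<rho>(1)] card_mono[OF finite_R \<rho>(1)] by simp
    moreover have "card (A R) = card (A \<rho>) + card (A R - A \<rho>)"
      using card_Diff_subset[OF finite_A, of \<rho> "A R"] card_mono[OF finite_A, of "A \<rho>" R]
        A_mono[OF \<rho>(1) order_refl] by simp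
    ultimately show ?thesis using rank_A[OF \<rho>(1)] m'(3) c'(3) by linarith
  qed
  ultimately show ?thesis by blast
qed

lemma pure_multicomplex_relaxed_coparking:
  assumes F: "fibre_system M B0 F"
  shows "pure_multicomplex (relaxed_coparking M B0 F)"
proof -
  let ?P = "relaxed_coparking M B0 F"
  have exp: "?P \<subseteq> exponents R" by (auto simp: relaxed_coparking_def)
  have "?P \<subseteq> (\<Union>k\<le>card (A R). {a \<in> exponents R. total_degree a = k})"
  proof
    fix a assume a: "a \<in> ?P"
    then obtain a' where "a' \<in> ?P" "a \<le> a'" "total_degree a' + card R = card (A R)"
      using relaxed_coparking_below_top_degree[OF F] by blast
    moreover from this have "total_degree a \<le> total_degree a'"
      using exp a by (intro total_degree_mono[of a R a'] finite_R) auto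
    ultimately have "total_degree a \<le> card (A R)" by simp
    then show "a \<in> (\<Union>k\<le>card (A R). {a \<in> exponents R. total_degree a = k})" using a exp by auto
  qed
  then have fin: "finite ?P"
    by (rule finite_subset) (use finite_exponents_degree[OF finite_R] in auto)
  have "c \<in> ?P" if a: "a \<in> ?P" and le: "c \<le> a" for a c
  proof -
    have le_at: "c i \<le> a i" for i using le by (simp add: le_fun_def)
    have "dead M B0 \<tau> \<and> residual M B0 \<tau> c \<in> F \<tau>" if \<tau>: "can_fire M B0 \<tau> c" for \<tau>
    proof -
      have "can_fire M B0 \<tau> a" using \<tau> le_at unfolding can_fire_iff by (meson order_trans)
      then have dead: "dead M B0 \<tau>" and r: "residual M B0 \<tau> a \<in> F \<tau>"
        using a by (auto simp: relaxed_coparking_def)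
      have "residual M B0 \<tau> c \<le> residual M B0 \<tau> a"
        using le_at by (auto simp: residual_def le_fun_def intro: diff_le_mono)
      moreover have "multicomplex (F \<tau>)"
        using F dead by (auto simp: fibre_system_def is_fibre_def pure_multicomplex_def)
      ultimately show ?thesis using dead r unfolding multicomplex_def by blast
    qed
    moreover have "c \<in> exponents R" using exponents_downward[OF _ le] a exp by blast
    ultimately show ?thesis by (simp add: relaxed_coparking_def)
  qed
  moreover have "finite {i. a i \<noteq> 0}" if "a \<in> ?P" for a
    using finite_support[of a R] that exp finite_R by auto
  ultimately have "multicomplex ?P" using fin unfolding multicomplex_def by blast
  moreover have "total_degree a + card R = card (A R)" if max: "maximal_in ?P a" for a
    using relaxed_coparking_below_top_degree[OF F, of a] max unfolding maximal_in_def by metis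
  ultimately show ?thesis unfolding pure_multicomplex_def by (metis add_right_cancel)
qed

end

section \<open>Stanley's conjecture for matroids with a fibre system\<close>

text \<open>Pure \<open>O\<close>-sequences are defined by multicomplexes in variables indexed by \<open>nat\<close>, so the variables are
  renamed along an injection of \<open>V\<close> into \<open>nat\<close>.\<close>

lemma pure_O_sequence_of_pure_multicomplex:
  fixes \<Delta> :: "('v \<Rightarrow> nat) set"
  assumes pure: "pure_multicomplex \<Delta>" and exp: "\<Delta> \<subseteq> exponents V" and fin: "finite V"
  shows "pure_O_sequence (degree_sequence \<Delta>)"
proof -
  obtain g :: "'v \<Rightarrow> nat" where g: "inj_on g V"
    using fin finite_imp_inj_to_nat_seg by blast
  define \<phi> where "\<phi> a = (\<lambda>n. if n \<in> g ` V then a (inv_into V g n) else 0)" for a :: "'v \<Rightarrow> nat"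
  define \<psi> where "\<psi> c = (\<lambda>v. if v \<in> V then c (g v) else 0)" for c :: "nat \<Rightarrow> nat"
  have \<psi>\<phi>: "\<psi> (\<phi> a) = a" if "a \<in> exponents V" for a
    using that g by (auto simp: \<phi>_def \<psi>_def exponents_def fun_eq_iff)
  have \<phi>\<psi>: "\<phi> (\<psi> c) = c" if "c \<in> exponents (g ` V)" for c
    using that g by (auto simp: \<phi>_def \<psi>_def exponents_def fun_eq_iff inv_into_into)
  have \<phi>_mono: "\<phi> a \<le> \<phi> a'" if "a \<le> a'" for a a' using that by (auto simp: \<phi>_def le_fun_def)
  have \<psi>_mono: "\<psi> c \<le> \<psi> c'" if "c \<le> c'" for c c' using that by (auto simp: \<psi>_def le_fun_def)
  have \<phi>_exp: "\<phi> a \<in> exponents (g ` V)" for a by (simp add: \<phi>_def exponents_def)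
  have deg: "total_degree (\<phi> a) = total_degree a" if "a \<in> exponents V" for a
  proof -
    have "total_degree (\<phi> a) = sum (\<phi> a) (g ` V)"
      using fin by (intro total_degree_eq_sum[OF \<phi>_exp]) auto
    also have "\<dots> = (\<Sum>v\<in>V. \<phi> a (g v))" by (simp add: sum.reindex[OF g])
    also have "\<dots> = sum a V" by (rule sum.cong) (use g in \<open>auto simp: \<phi>_def\<close>)
    finally show ?thesis using total_degree_eq_sum[OF that fin] by simp
  qed
  have inj: "inj_on \<phi> \<Delta>" using \<psi>\<phi> exp by (metis inj_on_inverseI subsetD)
  have mc: "multicomplex \<Delta>" using pure by (simp add: pure_multicomplex_def)
  have "multicomplex (\<phi> ` \<Delta>)"
    unfolding multicomplex_def
  proof (intro conjI ballI allI impI)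
    show "finite (\<phi> ` \<Delta>)" using mc by (simp add: multicomplex_def)
    fix c assume c: "c \<in> \<phi> ` \<Delta>"
    have "c \<in> exponents (g ` V)" using c \<phi>_exp by auto
    then show "finite {n. c n \<noteq> 0}" using finite_support fin by blast
    fix c' assume le: "c' \<le> c"
    obtain a where a: "a \<in> \<Delta>" "c = \<phi> a" using c by auto
    have "c' \<in> exponents (g ` V)"
      using exponents_downward[OF _ le] \<phi>_exp a by simp
    moreover have "\<psi> c' \<le> a" using \<psi>_mono[OF le] \<psi>\<phi> a exp by auto
    then have "\<psi> c' \<in> \<Delta>" using mc a unfolding multicomplex_def by blast
    ultimately show "c' \<in> \<phi> ` \<Delta>" using \<phi>\<psi> by (metis imageI)
  qed
  moreover have max: "\<exists>a. c = \<phi> a \<and> maximal_in \<Delta> a" if "maximal_in (\<phi> ` \<Delta>) c" for c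
  proof -
    have "c \<in> \<phi> ` \<Delta>" using that unfolding maximal_in_def by simp
    then obtain a where a: "a \<in> \<Delta>" "c = \<phi> a" by auto
    have "a' = a" if "a' \<in> \<Delta>" "a \<le> a'" for a'
      using \<open>maximal_in (\<phi> ` \<Delta>) c\<close> a that \<phi>_mono[OF that(2)] inj
      unfolding maximal_in_def by (metis imageI inj_onD)
    then show ?thesis using a unfolding maximal_in_def by blast
  qed
  have "total_degree c = total_degree c'"
    if c: "maximal_in (\<phi> ` \<Delta>) c" and c': "maximal_in (\<phi> ` \<Delta>) c'" for c c'
  proof -
    obtain a a' where "c = \<phi> a" "c' = \<phi> a'" "maximal_in \<Delta> a" "maximal_in \<Delta> a'"
      using max[OF c] max[OF c'] by auto
    moreover from this have "a \<in> exponents V" "a' \<in> exponents V"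
      using exp by (auto simp: maximal_in_def)
    ultimately show ?thesis using pure deg unfolding pure_multicomplex_def by metis
  qed
  ultimately have "pure_multicomplex (\<phi> ` \<Delta>)" unfolding pure_multicomplex_def by blast
  moreover have "degree_sequence (\<phi> ` \<Delta>) = degree_sequence \<Delta>"
  proof
    fix k
    have "{c \<in> \<phi> ` \<Delta>. total_degree c = k} = \<phi> ` {a \<in> \<Delta>. total_degree a = k}"
      using deg exp by auto
    moreover have "card (\<phi> ` {a \<in> \<Delta>. total_degree a = k}) = card {a \<in> \<Delta>. total_degree a = k}"
      by (rule card_image) (rule inj_on_subset[OF inj], auto)
    ultimately show "degree_sequence (\<phi> ` \<Delta>) k = degree_sequence \<Delta> k"
      by (simp add: degree_sequence_def)
  qed
  ultimately show ?thesis unfolding pure_O_sequence_def by blast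
qed

theorem theorem1p2:
  fixes M :: "'a indep_structure" and B0 :: "'a set"
  assumes "matroid M" and "basis M B0"
  shows "(\<forall>F. fibre_system M B0 F \<longrightarrow>
            pure_multicomplex (relaxed_coparking M B0 F) \<and>
            degree_sequence (relaxed_coparking M B0 F) = h_vector M) \<and>
         ((\<exists>F. fibre_system M B0 F) \<longrightarrow> pure_O_sequence (h_vector M))"
proof -
  interpret based_matroid M B0
    using assms by (intro based_matroid.intro based_matroid_axioms.intro)
  have "pure_O_sequence (h_vector M)" if F: "fibre_system M B0 F" for F
  proof -
    have "relaxed_coparking M B0 F \<subseteq> exponents R" by (auto simp: relaxed_coparking_def)
    then show ?thesis
      using pure_O_sequence_of_pure_multicomplex[OF pure_multicomplex_relaxed_coparking[OF F] _ finite_R]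
        degree_sequence_relaxed_coparking[OF F] by simp
  qed
  then show ?thesis
    using pure_multicomplex_relaxed_coparking degree_sequence_relaxed_coparking by blast
qed


end
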